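(* Let $P$ be a path linkage with $k\ge2$ edges, all of positive length, and let $p,q\in M(P)$. Let $\alpha:[0,1]\to[P]$ be continuous such that, for some $\epsilon>0$ and $\delta>0$, $\alpha(x)=\theta(p)$ for all $x\in[0,\epsilon]$ and $\alpha(x)=\theta(q)$ for all $x\in[1-\delta,1]$. If $\alpha([0,1])\cap\nabla(P)\ne\emptyset$, then there exists a continuous $\tilde\alpha:[0,1]\to M(P)$ with $\tilde\alpha(0)=p$, $\tilde\alpha(1)=q$ and $\theta\circ\tilde\alpha=\alpha$.
   Context: A path linkage is a linkage $P=(G,l)$ where $G$ is a path graph with vertices $1,\dots,k+1$ and edges $\{i,i+1\}$; its terminal vertices are $s=1$, $t=k+1$. $C(P)=\{p:V\to\mathbb R^2:|p(u)-p(v)|=l(\{u,v\})\text{ for every edge}\}$, and $M(P)$ is the quotient of $C(P)$ by the group of orientation preserving isometries of $\mathbb R^2$, with the quotient topology. $\theta:M(P)\to\mathbb R$, $\theta(p)=|p(s)-p(t)|$, and $[P]=\theta(M(P))$. $\nabla(P)=\{x\in[P]:\theta^{-1}(x)\text{ is connected}\}$. *)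

theory Defs
  imports "HOL-Analysis.Analysis"
begin

text \<open>A path linkage with k edges: vertices 1..k+1, edges {i,i+1} for i in 1..k,
  edge {i,i+1} has length l i.  The plane R^2 is identified with the complex plane.
  Configurations are functions on the vertex set {1..k+1} (extensional, i.e. PiE).\<close>

definition conf_space :: "nat \<Rightarrow> (nat \<Rightarrow> real) \<Rightarrow> (nat \<Rightarrow> complex) set" where
  "conf_space k l = {p \<in> {1..k+1} \<rightarrow>\<^sub>E (UNIV :: complex set).
       \<forall>i\<in>{1..k}. cmod (p i - p (Suc i)) = l i}"

definition conf_top :: "nat \<Rightarrow> (nat \<Rightarrow> real) \<Rightarrow> (nat \<Rightarrow> complex) topology" where
  "conf_top k l = subtopology (product_topology (\<lambda>_. euclidean) {1..k+1}) (conf_space k l)"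

definition orient_iso :: "(complex \<Rightarrow> complex) \<Rightarrow> bool" where
  "orient_iso g \<longleftrightarrow> (\<exists>a b. cmod a = 1 \<and> g = (\<lambda>z. a * z + b))"

definition orbit :: "nat \<Rightarrow> (nat \<Rightarrow> real) \<Rightarrow> (nat \<Rightarrow> complex) \<Rightarrow> (nat \<Rightarrow> complex) set" where
  "orbit k l p = {q \<in> conf_space k l. \<exists>g. orient_iso g \<and> (\<forall>i\<in>{1..k+1}. q i = g (p i))}"

definition moduli :: "nat \<Rightarrow> (nat \<Rightarrow> real) \<Rightarrow> (nat \<Rightarrow> complex) set set" where
  "moduli k l = orbit k l ` conf_space k l"

definition moduli_top :: "nat \<Rightarrow> (nat \<Rightarrow> real) \<Rightarrow> (nat \<Rightarrow> complex) set topology" where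
  "moduli_top k l = topology (\<lambda>U. U \<subseteq> moduli k l \<and>
      openin (conf_top k l) {p \<in> topspace (conf_top k l). orbit k l p \<in> U})"

lemma istopology_quotient:
  "istopology (\<lambda>U. U \<subseteq> f ` topspace X \<and> openin X {x \<in> topspace X. f x \<in> U})"
proof -
  have i: "{x \<in> topspace X. f x \<in> S \<inter> T} = {x \<in> topspace X. f x \<in> S} \<inter> {x \<in> topspace X. f x \<in> T}"
    for S T by auto
  have u: "{x \<in> topspace X. f x \<in> \<Union>K} = (\<Union>S\<in>K. {x \<in> topspace X. f x \<in> S})" for K by auto
  show ?thesis
    unfolding istopology_def i u
    by (auto intro!: openin_Union openin_Int)
qed

lemma topspace_conf_top: "topspace (conf_top k l) = conf_space k l"
  unfolding conf_top_def conf_space_def by (auto simp: topspace_product_topology)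

lemma openin_moduli_top:
  "openin (moduli_top k l) U \<longleftrightarrow> U \<subseteq> moduli k l \<and>
      openin (conf_top k l) {p \<in> topspace (conf_top k l). orbit k l p \<in> U}"
  unfolding moduli_top_def moduli_def
  using istopology_quotient[of "orbit k l" "conf_top k l"]
  by (simp add: topspace_conf_top)

text \<open>theta: distance between the terminal vertices s = 1 and t = k+1 (well defined on orbits).\<close>
definition theta :: "nat \<Rightarrow> (nat \<Rightarrow> complex) set \<Rightarrow> real" where
  "theta k c = (SOME r. \<exists>p\<in>c. r = cmod (p 1 - p (k+1)))"

definition range_P :: "nat \<Rightarrow> (nat \<Rightarrow> real) \<Rightarrow> real set" where
  "range_P k l = theta k ` moduli k l"

definition nabla :: "nat \<Rightarrow> (nat \<Rightarrow> real) \<Rightarrow> real set" where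
  "nabla k l = {x \<in> range_P k l. connectedin (moduli_top k l) {c \<in> moduli k l. theta k c = x}}"

end

theory Submission
  imports Defs
begin

text \<open>A configuration modulo isometries is a tuple of unit edge directions \<open>z\<close> modulo rotation, and
  \<open>\<theta>\<close> is \<open>\<bar>\<Sum> l i * z i\<bar>\<close>. Up to reflection every path \<open>\<alpha>\<close> that is constant near its ends lifts with
  prescribed ends, and the reflection can be avoided if \<open>\<alpha>\<close> meets a value \<open>x\<close> whose fibre contains a
  configuration with the two longest edges \<open>u\<close>, \<open>v\<close> parallel or antiparallel. If there is no such
  configuration, the sign of the angle between \<open>u\<close> and \<open>v\<close> disconnects the fibre, so all of \<open>\<nabla>\<close>
  consists of such values.

  The lifting is by induction on the number of edges. Peel off an edge of length \<open>h\<close>: over \<open>x\<close>, the rest of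
  the chain has some end distance \<open>\<rho>\<close> and forms a triangle with sides \<open>\<rho>\<close>, \<open>h\<close>, \<open>x\<close>. One chooses a path
  \<open>\<rho>(t)\<close> subject to the triangle inequalities, lifts it by induction, and adds the last edge. The two
  obstructions, the component of the shorter chain and the orientation of the triangle, are
  switched when \<open>\<rho>\<close> passes a value where the two longest edges are parallel, or a flat triangle. The largest
  admissible \<open>\<rho>\<close> always allows one of the switches, so one switch happens during the initial
  constant stretch and the other one at the special time; thus they never have to happen
  simultaneously.\<close>

section \<open>Lifts of distance paths\<close>

definition unimod :: "nat set \<Rightarrow> (nat \<Rightarrow> complex) \<Rightarrow> bool" where
  "unimod E z \<longleftrightarrow> (\<forall>i\<in>E. cmod (z i) = 1)"

definition esum :: "(nat \<Rightarrow> real) \<Rightarrow> nat set \<Rightarrow> (nat \<Rightarrow> complex) \<Rightarrow> complex" where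
  "esum l E z = (\<Sum>i\<in>E. complex_of_real (l i) * z i)"

definition lifts :: "(nat \<Rightarrow> real) \<Rightarrow> nat set \<Rightarrow> (real \<Rightarrow> real) \<Rightarrow> (real \<Rightarrow> nat \<Rightarrow> complex) \<Rightarrow> bool" where
  "lifts l E \<alpha> Z \<longleftrightarrow> (\<forall>i\<in>E. continuous_on {0..1} (\<lambda>t. Z t i)) \<and>
     (\<forall>t\<in>{0..1}. unimod E (Z t) \<and> cmod (esum l E (Z t)) = \<alpha> t)"

text \<open>The ends are prescribed exactly, not only up to rotation, so that lifts with a common
  end can be concatenated.\<close>

definition joined :: "(nat \<Rightarrow> real) \<Rightarrow> nat set \<Rightarrow> (real \<Rightarrow> real) \<Rightarrow> (nat \<Rightarrow> complex) \<Rightarrow> (nat \<Rightarrow> complex) \<Rightarrow> bool" where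
  "joined l E \<alpha> p q \<longleftrightarrow> (\<exists>Z. lifts l E \<alpha> Z \<and> (\<forall>i\<in>E. Z 0 i = p i \<and> Z 1 i = q i))"

text \<open>By the polygon inequalities these are exactly the distances that a chain with edge set
  \<open>E\<close> can realise, but only the inclusion \<open>esum_in_reach\<close> is ever needed.\<close>

definition reach :: "(nat \<Rightarrow> real) \<Rightarrow> nat set \<Rightarrow> real set" where
  "reach l E = {x. 0 \<le> x \<and> x \<le> sum l E \<and> (\<forall>j\<in>E. 2 * l j - sum l E \<le> x)}"

text \<open>One \<epsilon> serves both ends; the bound 1/2 keeps the two constant stretches from
  overlapping in more than a point.\<close>

definition flat_ends :: "real \<Rightarrow> (real \<Rightarrow> real) \<Rightarrow> bool" where
  "flat_ends \<epsilon> \<alpha> \<longleftrightarrow> 0 < \<epsilon> \<and> \<epsilon> \<le> 1/2 \<and> (\<forall>t\<in>{0..\<epsilon>}. \<alpha> t = \<alpha> 0) \<and> (\<forall>t\<in>{1-\<epsilon>..1}. \<alpha> t = \<alpha> 1)"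

text \<open>This is the induction hypothesis. The first conjunct says that reflection is the only
  obstruction, the second that it disappears once \<alpha> meets \<open>G\<close>; peeling off an
  edge uses both.\<close>

definition liftable :: "(nat \<Rightarrow> real) \<Rightarrow> nat set \<Rightarrow> real set \<Rightarrow> bool" where
  "liftable l E G \<longleftrightarrow> (\<forall>\<alpha> p q \<epsilon>.
     continuous_on {0..1} \<alpha> \<longrightarrow> \<alpha> ` {0..1} \<subseteq> reach l E \<longrightarrow> flat_ends \<epsilon> \<alpha> \<longrightarrow>
     unimod E p \<longrightarrow> unimod E q \<longrightarrow> cmod (esum l E p) = \<alpha> 0 \<longrightarrow> cmod (esum l E q) = \<alpha> 1 \<longrightarrow>
     (joined l E \<alpha> p q \<or> joined l E \<alpha> (cnj \<circ> p) q) \<and>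
     (\<alpha> ` {0..1} \<inter> G \<noteq> {} \<longrightarrow> joined l E \<alpha> p q))"

section \<open>Edge sums and the polygon inequality\<close>

lemma esum_cong: "(\<And>i. i \<in> E \<Longrightarrow> z i = w i) \<Longrightarrow> esum l E z = esum l E w"
  by (auto simp: esum_def)

lemma esum_insert:
  "finite E \<Longrightarrow> e \<notin> E \<Longrightarrow> esum l (insert e E) z = esum l E z + complex_of_real (l e) * z e"
  by (simp add: esum_def)

lemma esum_cnj: "esum l E (cnj \<circ> z) = cnj (esum l E z)"
  by (simp add: esum_def)

lemma unimod_cnj: "unimod E (cnj \<circ> z) = unimod E z"
  by (simp add: unimod_def)

lemma cmod_esum_le:
  assumes "unimod E z" "\<And>i. i \<in> E \<Longrightarrow> l i \<ge> 0"
  shows "cmod (esum l E z) \<le> sum l E"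
  unfolding esum_def using assms
  by (intro sum_norm_le) (auto simp: norm_mult unimod_def)

text \<open>The upper bound is the triangle inequality; for the lower one, edge \<open>j\<close> is
  the difference of the whole sum and the sum over \<open>E - {j}\<close>.\<close>

lemma esum_in_reach:
  assumes "finite E" "unimod E z" "\<And>i. i \<in> E \<Longrightarrow> l i \<ge> 0"
  shows "cmod (esum l E z) \<in> reach l E"
proof -
  have "2 * l j - sum l E \<le> cmod (esum l E z)" if j: "j \<in> E" for j
  proof -
    have E: "E = insert j (E - {j})" using j by auto
    have 1: "esum l E z = esum l (E - {j}) z + complex_of_real (l j) * z j"
      by (subst E, subst esum_insert) (use assms in auto)
    have 2: "cmod (esum l (E - {j}) z) \<le> sum l (E - {j})"
      by (rule cmod_esum_le) (use assms in \<open>auto simp: unimod_def\<close>)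
    have 3: "sum l E = sum l (E - {j}) + l j"
      using assms j by (simp add: sum.remove)
    have "cmod (l j * z j) \<le> cmod (esum l E z) + cmod (esum l (E - {j}) z)"
      unfolding 1 by (metis add_diff_cancel_left' norm_triangle_ineq4)
    moreover have "cmod (l j * z j) = l j"
      using assms j by (simp add: norm_mult unimod_def)
    ultimately show ?thesis using 2 3 by linarith
  qed
  then show ?thesis
    using cmod_esum_le[of E z l] assms by (auto simp: reach_def)
qed

section \<open>Reflection, reversal and concatenation of lifts\<close>

lemma joined_cnj:
  assumes "joined l E \<alpha> p q"
  shows "joined l E \<alpha> (cnj \<circ> p) (cnj \<circ> q)"
proof -
  from assms obtain Z where Z: "lifts l E \<alpha> Z" "\<forall>i\<in>E. Z 0 i = p i \<and> Z 1 i = q i"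
    unfolding joined_def by blast
  have "lifts l E \<alpha> (\<lambda>t. cnj \<circ> Z t)"
    using Z(1) unfolding lifts_def unimod_cnj esum_cnj by (auto intro!: continuous_intros)
  then show ?thesis unfolding joined_def using Z(2) by (intro exI[of _ "\<lambda>t. cnj \<circ> Z t"]) auto
qed

lemma joined_reverse:
  assumes "joined l E \<alpha> p q"
  shows "joined l E (\<lambda>t. \<alpha> (1 - t)) q p"
proof -
  from assms obtain Z where Z: "lifts l E \<alpha> Z" "\<forall>i\<in>E. Z 0 i = p i \<and> Z 1 i = q i"
    unfolding joined_def by blast
  have "continuous_on {0..1} (\<lambda>t. Z (1 - t) i)" if "i \<in> E" for i
    using Z(1) that unfolding lifts_def
    by (intro continuous_on_compose2[of "{0..1}" "\<lambda>t. Z t i" _ "\<lambda>t. 1 - t"] continuous_intros) auto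
  then have "lifts l E (\<lambda>t. \<alpha> (1 - t)) (\<lambda>t. Z (1 - t))"
    using Z(1) unfolding lifts_def by auto
  then show ?thesis unfolding joined_def using Z(2) by (intro exI[of _ "\<lambda>t. Z (1 - t)"]) auto
qed

lemma flat_endsD:
  assumes "flat_ends \<epsilon> \<alpha>"
  shows "0 < \<epsilon>" "\<epsilon> \<le> 1/2" "\<And>t. 0 \<le> t \<Longrightarrow> t \<le> \<epsilon> \<Longrightarrow> \<alpha> t = \<alpha> 0"
    "\<And>t. 1 - \<epsilon> \<le> t \<Longrightarrow> t \<le> 1 \<Longrightarrow> \<alpha> t = \<alpha> 1"
  using assms unfolding flat_ends_def by (blast, blast, metis atLeastAtMost_iff, metis atLeastAtMost_iff)

text \<open>The constant stretch at the start gives time to run an extra motion at fixed end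
  distance before following the given lift.\<close>

lemma joined_prepend:
  assumes flat: "flat_ends \<epsilon> \<alpha>" and pp: "joined l E (\<lambda>_. \<alpha> 0) p p'" and pq: "joined l E \<alpha> p' q"
  shows "joined l E \<alpha> p q"
proof -
  from pp obtain Y where Y: "lifts l E (\<lambda>_. \<alpha> 0) Y" "\<forall>i\<in>E. Y 0 i = p i \<and> Y 1 i = p' i"
    unfolding joined_def by blast
  from pq obtain Z where Z: "lifts l E \<alpha> Z" "\<forall>i\<in>E. Z 0 i = p' i \<and> Z 1 i = q i"
    unfolding joined_def by blast
  have e: "0 < \<epsilon>" "\<epsilon> \<le> 1/2" and fl: "\<And>t. 0 \<le> t \<Longrightarrow> t \<le> \<epsilon> \<Longrightarrow> \<alpha> t = \<alpha> 0"
    by (fact flat_endsD[OF flat])+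
  \<comment> \<open>\<eta> waits at 0 until \<epsilon>/2, catches up at double speed until
    \<epsilon> and is the identity afterwards, so \<alpha> \<circ> \<eta> = \<alpha>.\<close>
  define \<eta> where "\<eta> t = max 0 (min t (2*t - \<epsilon>))" for t :: real
  define W where "W t = (if t \<le> \<epsilon>/2 then Y (2*t/\<epsilon>) else Z (\<eta> t))" for t
  have \<eta>1: "\<eta> t \<in> {0..1}" if "t \<in> {0..1}" for t using that e by (auto simp: \<eta>_def)
  have \<alpha>\<eta>: "\<alpha> (\<eta> t) = \<alpha> t" if "t \<in> {0..1}" for t
  proof (cases "t \<le> \<epsilon>")
    case True
    then show ?thesis using that fl[of t] fl[of "\<eta> t"] by (auto simp: \<eta>_def)
  next
    case False
    then show ?thesis using that e by (auto simp: \<eta>_def)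
  qed
  have "continuous_on {0..1} (\<lambda>t. W t i)" if i: "i \<in> E" for i
  proof -
    have "continuous_on ({0..\<epsilon>/2} \<union> {\<epsilon>/2..1}) (\<lambda>t. if t \<le> \<epsilon>/2 then Y (2*t/\<epsilon>) i else Z (\<eta> t) i)"
    proof (rule continuous_on_cases)
      show "continuous_on {0..\<epsilon>/2} (\<lambda>t. Y (2*t/\<epsilon>) i)"
        using Y(1) i e unfolding lifts_def
        by (intro continuous_on_compose2[of "{0..1}" "\<lambda>t. Y t i" _ "\<lambda>t. 2*t/\<epsilon>"] continuous_intros)
           (auto simp: field_simps)
      show "continuous_on {\<epsilon>/2..1} (\<lambda>t. Z (\<eta> t) i)"
        using Z(1) i e \<eta>1 unfolding lifts_def
        by (intro continuous_on_compose2[of "{0..1}" "\<lambda>t. Z t i" _ \<eta>])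
           (auto simp: \<eta>_def intro!: continuous_intros)
      show "\<forall>t. t \<in> {0..\<epsilon>/2} \<and> \<not> t \<le> \<epsilon>/2 \<or> t \<in> {\<epsilon>/2..1} \<and> t \<le> \<epsilon>/2 \<longrightarrow> Y (2*t/\<epsilon>) i = Z (\<eta> t) i"
        using Y(2) Z(2) i e by (auto simp: \<eta>_def)
    qed auto
    moreover have "{0..\<epsilon>/2} \<union> {\<epsilon>/2..1} = {0..1::real}" using e by auto
    ultimately show ?thesis by (simp add: W_def if_distrib[of "\<lambda>f. f i"])
  qed
  moreover have "unimod E (W t) \<and> cmod (esum l E (W t)) = \<alpha> t" if t: "t \<in> {0..1}" for t
  proof (cases "t \<le> \<epsilon>/2")
    case True
    then have "2*t/\<epsilon> \<in> {0..1}" using t e by (auto simp: field_simps)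
    then show ?thesis using Y(1) True t e fl[of t] by (auto simp: lifts_def W_def)
  next
    case False
    then show ?thesis using Z(1) \<eta>1[OF t] \<alpha>\<eta>[OF t] by (auto simp: lifts_def W_def)
  qed
  ultimately have "lifts l E \<alpha> W" by (auto simp: lifts_def)
  moreover have "\<eta> 1 = 1" using e by (auto simp: \<eta>_def)
  ultimately show ?thesis unfolding joined_def using Y(2) Z(2) e
    by (intro exI[of _ W]) (auto simp: W_def)
qed

lemma flat_ends_reverse:
  assumes "flat_ends \<epsilon> \<alpha>" shows "flat_ends \<epsilon> (\<lambda>t. \<alpha> (1 - t))"
  unfolding flat_ends_def
proof (intro conjI ballI)
  show "\<alpha> (1 - t) = \<alpha> (1 - 0)" if "t \<in> {0..\<epsilon>}" for t
    using flat_endsD(4)[OF assms, of "1 - t"] that by simp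
  show "\<alpha> (1 - t) = \<alpha> (1 - 1)" if "t \<in> {1-\<epsilon>..1}" for t
    using flat_endsD(3)[OF assms, of "1 - t"] that by simp
qed (rule flat_endsD[OF assms])+

text \<open>Time reversal of \<open>joined_prepend\<close>. The constant path runs from
  \<open>q\<close> to \<open>q'\<close> because \<open>move_off_zero\<close> supplies it in that
  direction.\<close>

lemma joined_append:
  assumes flat: "flat_ends \<epsilon> \<alpha>" and pq: "joined l E \<alpha> p q'" and qq: "joined l E (\<lambda>_. \<alpha> 1) q q'"
  shows "joined l E \<alpha> p q"
proof -
  have "joined l E (\<lambda>t. \<alpha> (1 - t)) q p"
    by (rule joined_prepend[OF flat_ends_reverse[OF flat] _ joined_reverse[OF pq]]) (use qq in simp)
  from joined_reverse[OF this] show ?thesis by simp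
qed

lemma joined_const_trans:
  assumes "joined l E (\<lambda>_. x) p q" "joined l E (\<lambda>_. x) q r"
  shows "joined l E (\<lambda>_. x) p r"
  by (rule joined_prepend[of "1/2" "\<lambda>_. x", OF _ assms]) (simp add: flat_ends_def)

lemma joined_const_refl:
  assumes "unimod E p" "cmod (esum l E p) = x"
  shows "joined l E (\<lambda>_. x) p p"
  using assms unfolding joined_def lifts_def by (intro exI[of _ "\<lambda>_. p"]) auto

section \<open>Leaving configurations in which the other edges close up\<close>

lemma unit_rotation:
  assumes "cmod z = 1" "cmod w = 1"
  obtains a where "z * cis a = w"
proof
  have nz: "z \<noteq> 0" "w \<noteq> 0" using assms by auto
  then have "cis (Arg (w / z)) = w / z" using cis_Arg[of "w / z"] assms by (simp add: norm_divide sgn_div_norm)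
  then show "z * cis (Arg (w / z)) = w" using nz by simp
qed

text \<open>If the chain without edge \<open>e\<close> closes up, then \<open>e\<close> rotates freely; turn it parallel to some
  other edge \<open>i\<close>, after which both can be turned simultaneously, keeping the end distance.\<close>

lemma move_off_zero:
  assumes fin: "finite E" and ne: "E \<noteq> {}" and e: "e \<notin> E" and pos: "\<And>i. i \<in> insert e E \<Longrightarrow> l i > 0"
    and p: "unimod (insert e E) p" and x: "cmod (esum l (insert e E) p) = x"
  obtains p' where "unimod (insert e E) p'" "cmod (esum l (insert e E) p') = x"
    "joined l (insert e E) (\<lambda>_. x) p p'" "cmod (esum l E p') > 0"
proof (cases "esum l E p = 0")
  case False
  then show ?thesis using that[of p] p x joined_const_refl[of "insert e E" p l x] by auto
next
  case True
  define h where "h = l e"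
  have h: "h > 0" using pos by (auto simp: h_def)
  have ue: "cmod (p e) = 1" using p by (auto simp: unimod_def)
  have xh: "x = h" using x ue h by (simp add: esum_insert[OF fin e] True norm_mult h_def)
  obtain i where i: "i \<in> E" using ne by auto
  have ie: "i \<noteq> e" using i e by auto
  have ui: "cmod (p i) = 1" using p i by (auto simp: unimod_def)
  obtain a where "p e * cis a = p i" using unit_rotation[OF ue ui] .
  define p1 where "p1 = p(e := p i)"
  \<comment> \<open>Turning \<open>e\<close> alone keeps the end distance at \<open>h\<close>,
    because the rest sums to 0.\<close>
  have "joined l (insert e E) (\<lambda>_. x) p p1"
    unfolding joined_def
  proof (intro exI conjI ballI)
    show "lifts l (insert e E) (\<lambda>_. x) (\<lambda>t. p(e := p e * cis (t * a)))"
      unfolding lifts_def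
    proof (intro conjI ballI)
      fix j assume "j \<in> insert e E"
      show "continuous_on {0..1} (\<lambda>t. (p(e := p e * cis (t * a))) j)"
        by (cases "j = e") (auto intro!: continuous_intros)
    next
      fix t :: real
      show "unimod (insert e E) (p(e := p e * cis (t * a)))"
        using p by (auto simp: unimod_def norm_mult)
      have "esum l E (p(e := p e * cis (t * a))) = esum l E p"
        by (rule esum_cong) (use e in auto)
      then show "cmod (esum l (insert e E) (p(e := p e * cis (t * a)))) = x"
        by (simp add: esum_insert[OF fin e] True norm_mult ue xh h_def[symmetric] h less_imp_le)
    qed
  qed (use \<open>p e * cis a = p i\<close> in \<open>auto simp: p1_def\<close>)
  \<comment> \<open>The choice of \<open>b\<close> gives \<open>l i * sin (t * b) \<le> h\<close>,
    which makes the radicand of \<open>y\<close> nonnegative.\<close>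
  define b where "b = min 1 (h / l i)"
  have li: "l i > 0" using pos i by auto
  have b: "0 < b" "b \<le> 1" "l i * b \<le> h" using h li by (auto simp: b_def min_def field_simps)
  define y where "y t = sqrt (h\<^sup>2 - (l i)\<^sup>2 * (sin (t * b))\<^sup>2)" for t
  \<comment> \<open>Edge \<open>i\<close> turns by \<open>2 * (t * b)\<close>, so the rest sums to a
    chord of length \<open>2 * l i * sin (t * b)\<close> in direction
    \<open>\<i> * p i * cis (t * b)\<close>. Edge \<open>e\<close> cancels half of this chord and
    adds \<open>y t\<close> perpendicular to it; the resulting vector has length \<open>h\<close> by
    the choice of \<open>y\<close>.\<close>
  define p2 where "p2 t = p(i := p i * cis (2 * (t * b)),
      e := p i * cis (t * b) * (Complex (y t / h) (- l i * sin (t * b) / h)))" for t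
  have sb: "0 \<le> sin (t * b)" "l i * sin (t * b) \<le> h" if "t \<in> {0..1}" for t
  proof -
    have "t * b \<le> 1 * b" using that b by (intro mult_right_mono) auto
    then have tb: "0 \<le> t * b" "t * b \<le> b" using that b by auto
    moreover have "t * b \<le> pi" using tb b pi_gt3 by linarith
    ultimately show "0 \<le> sin (t * b)" by (intro sin_ge_zero) auto
    have "sin (t * b) \<le> b" using tb sin_x_le_x[of "t * b"] by linarith
    then show "l i * sin (t * b) \<le> h" using b li by (smt (verit) mult_left_mono)
  qed
  have y2: "(y t)\<^sup>2 = h\<^sup>2 - (l i)\<^sup>2 * (sin (t * b))\<^sup>2" if "t \<in> {0..1}" for t
  proof -
    have "(l i * sin (t * b))\<^sup>2 \<le> h\<^sup>2" using sb[OF that] li by (intro power_mono) auto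
    then show ?thesis unfolding y_def by (simp add: power_mult_distrib)
  qed
  have dbl: "cis (2 * s) - 1 = 2 * \<i> * sin s * cis s" for s
  proof -
    have "cos (2 * s) = 1 - 2 * (sin s)\<^sup>2" by (simp add: cos_double_sin)
    then show ?thesis
      by (intro complex_eqI) (simp_all add: sin_double power2_eq_square)
  qed
  have es: "esum l E (p2 t) = complex_of_real (l i) * p i * (2 * \<i> * sin (t * b) * cis (t * b))" for t
  proof -
    have E: "E = insert i (E - {i})" using i by auto
    have 1: "esum l E z = esum l (E - {i}) z + complex_of_real (l i) * z i" for z
      by (subst E, subst esum_insert) (use fin in auto)
    have "esum l (E - {i}) (p2 t) = esum l (E - {i}) p"
      by (rule esum_cong) (use e in \<open>auto simp: p2_def\<close>)
    also have "\<dots> = - (complex_of_real (l i) * p i)" using 1[of p] True by (simp add: eq_neg_iff_add_eq_0)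
    finally have "esum l E (p2 t) = complex_of_real (l i) * p i * (cis (2 * (t * b)) - 1)"
      unfolding 1 using ie by (simp add: p2_def algebra_simps)
    then show ?thesis by (simp only: dbl)
  qed
  have L2: "lifts l (insert e E) (\<lambda>_. x) p2"
    unfolding lifts_def
  proof (intro conjI ballI)
    fix j assume "j \<in> insert e E"
    have c: "continuous_on {0..1} y" unfolding y_def by (intro continuous_intros)
    show "continuous_on {0..1} (\<lambda>t. p2 t j)"
      unfolding p2_def Complex_eq
      using h by (cases "j = e"; cases "j = i") (auto intro!: continuous_intros c)
  next
    fix t :: real assume t: "t \<in> {0..1}"
    have "(y t / h)\<^sup>2 + (- l i * sin (t * b) / h)\<^sup>2 = 1"
      using y2[OF t] h by (simp add: power_divide power_mult_distrib field_simps)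
    then have n: "cmod (Complex (y t / h) (- l i * sin (t * b) / h)) = 1"
      by (simp add: cmod_def)
    then show "unimod (insert e E) (p2 t)"
      using p ui by (auto simp: unimod_def p2_def norm_mult)
    have "esum l (insert e E) (p2 t) = p i * cis (t * b) * Complex (y t) (l i * sin (t * b))"
      unfolding esum_insert[OF fin e] es using h
      by (simp add: p2_def h_def[symmetric] Complex_eq field_simps)
    moreover have "(y t)\<^sup>2 + (l i * sin (t * b))\<^sup>2 = h\<^sup>2" using y2[OF t] by (simp add: power_mult_distrib)
    ultimately show "cmod (esum l (insert e E) (p2 t)) = x"
      using ui h by (simp add: norm_mult xh complex_norm)
  qed
  moreover have "\<forall>j\<in>insert e E. p2 0 j = p1 j"
    using h by (auto simp: p2_def p1_def y_def Complex_eq)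
  ultimately have "joined l (insert e E) (\<lambda>_. x) p1 (p2 1)"
    unfolding joined_def by blast
  with \<open>joined l (insert e E) (\<lambda>_. x) p p1\<close> have "joined l (insert e E) (\<lambda>_. x) p (p2 1)"
    by (rule joined_const_trans)
  moreover have "sin b > 0" using b pi_gt3 by (intro sin_gt_zero) auto
  then have "cmod (esum l E (p2 1)) > 0" unfolding es using li ui by (auto simp: norm_mult)
  moreover have "unimod (insert e E) (p2 1)" "cmod (esum l (insert e E) (p2 1)) = x"
    using L2 by (simp_all add: lifts_def)
  ultimately show ?thesis using that by blast
qed

section \<open>Adding an edge\<close>

text \<open>In a triangle with sides \<open>\<rho>\<close>, \<open>h\<close>, \<open>x\<close>, if the side \<open>\<rho>\<close> points in direction \<open>1\<close>,
  the side \<open>h\<close> points in direction \<open>tri \<rho> h x s\<close>, where \<open>s = \<plusminus>1\<close> is the orientation.\<close>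

definition tri_cos :: "real \<Rightarrow> real \<Rightarrow> real \<Rightarrow> real" where
  "tri_cos \<rho> h x = (x\<^sup>2 - \<rho>\<^sup>2 - h\<^sup>2) / (2 * \<rho> * h)"

definition tri :: "real \<Rightarrow> real \<Rightarrow> real \<Rightarrow> real \<Rightarrow> complex" where
  "tri \<rho> h x s = Complex (tri_cos \<rho> h x) (s * sqrt (1 - (tri_cos \<rho> h x)\<^sup>2))"

lemma cnj_tri: "cnj (tri \<rho> h x s) = tri \<rho> h x (- s)"
  by (simp add: tri_def complex_eq_iff)

text \<open>By the law of cosines \<open>tri_cos\<close> is the cosine of the angle between the
  directions of the two sides; the triangle inequalities amount to the bounds 1 and -1.\<close>

lemma tri_cos_le_1:
  assumes "\<rho> > 0" "h > 0" "x \<ge> 0" "\<bar>x - h\<bar> \<le> \<rho>" "\<rho> \<le> x + h"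
  shows "(tri_cos \<rho> h x)\<^sup>2 \<le> 1"
proof -
  have "x\<^sup>2 \<le> (\<rho> + h)\<^sup>2" using assms by (intro power_mono) auto
  then have 1: "tri_cos \<rho> h x \<le> 1"
    using assms by (simp add: tri_cos_def field_simps power2_eq_square)
  have "\<bar>\<rho> - h\<bar>\<^sup>2 \<le> x\<^sup>2" using assms by (intro power_mono) auto
  then have 2: "tri_cos \<rho> h x \<ge> -1"
    using assms by (simp add: tri_cos_def field_simps power2_eq_square)
  from 1 2 have "\<bar>tri_cos \<rho> h x\<bar> \<le> 1" by linarith
  then show ?thesis by (simp add: abs_square_le_1)
qed

lemma tri_cos_degenerate:
  assumes "\<rho> > 0" "h > 0" "\<rho> = \<bar>x - h\<bar> \<or> \<rho> = x + h"
  shows "(tri_cos \<rho> h x)\<^sup>2 = 1"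
proof -
  have "tri_cos \<rho> h x = 1 \<or> tri_cos \<rho> h x = -1"
    using assms by (auto simp: tri_cos_def field_simps power2_eq_square abs_if split: if_splits)
  then show ?thesis by auto
qed

lemma tri_props:
  assumes "\<rho> > 0" "h > 0" "x \<ge> 0" "\<bar>x - h\<bar> \<le> \<rho>" "\<rho> \<le> x + h" "s\<^sup>2 = 1"
  shows "cmod (tri \<rho> h x s) = 1" "cmod (\<rho> + h * tri \<rho> h x s) = x"
proof -
  define c where "c = tri_cos \<rho> h x"
  define y where "y = sqrt (1 - c\<^sup>2)"
  have y: "y\<^sup>2 = 1 - c\<^sup>2" using tri_cos_le_1[of \<rho> h x] assms by (simp add: y_def c_def)
  have c: "2 * \<rho> * h * c = x\<^sup>2 - \<rho>\<^sup>2 - h\<^sup>2" using assms by (simp add: c_def tri_cos_def)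
  show "cmod (tri \<rho> h x s) = 1"
    unfolding tri_def c_def[symmetric] y_def[symmetric] using y assms
    by (simp add: complex_norm power_mult_distrib)
  have "\<rho> + h * tri \<rho> h x s = Complex (\<rho> + h * c) (h * (s * y))"
    unfolding tri_def c_def[symmetric] y_def[symmetric] by (simp add: complex_eq_iff)
  moreover have "(\<rho> + h * c)\<^sup>2 + (h * (s * y))\<^sup>2 = \<rho>\<^sup>2 + 2 * \<rho> * h * c + h\<^sup>2 * (c\<^sup>2 + s\<^sup>2 * y\<^sup>2)"
    by (simp add: power2_eq_square algebra_simps)
  then have "(\<rho> + h * c)\<^sup>2 + (h * (s * y))\<^sup>2 = x\<^sup>2"
    unfolding c y assms by simp
  ultimately show "cmod (\<rho> + h * tri \<rho> h x s) = x" using assms by (simp add: complex_norm)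
qed

text \<open>The law of cosines determines the real part of \<open>w\<close>, and the unit length
  then leaves only the sign of the imaginary part.\<close>

lemma tri_complete:
  assumes "cmod w = 1" "\<rho> > 0" "h > 0" and x: "cmod (\<rho> + h * w) = x"
  obtains s where "s = 1 \<or> s = -1" "w = tri \<rho> h x s"
proof -
  have w: "(Re w)\<^sup>2 + (Im w)\<^sup>2 = 1" using assms(1) by (simp add: cmod_def)
  have "x\<^sup>2 = (\<rho> + h * Re w)\<^sup>2 + (h * Im w)\<^sup>2" using x by (simp flip: x add: cmod_power2)
  also have "\<dots> = \<rho>\<^sup>2 + 2 * \<rho> * h * Re w + h\<^sup>2 * ((Re w)\<^sup>2 + (Im w)\<^sup>2)"
    by (simp add: power2_eq_square algebra_simps)
  finally have "2 * \<rho> * h * Re w = x\<^sup>2 - \<rho>\<^sup>2 - h\<^sup>2" using w by simp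
  then have c: "Re w = tri_cos \<rho> h x" using assms by (simp add: tri_cos_def field_simps)
  have "1 - (tri_cos \<rho> h x)\<^sup>2 = (Im w)\<^sup>2" using w by (simp flip: c)
  then have "\<bar>Im w\<bar> = sqrt (1 - (tri_cos \<rho> h x)\<^sup>2)" by simp
  then have "Im w = 1 * sqrt (1 - (tri_cos \<rho> h x)\<^sup>2) \<or> Im w = -1 * sqrt (1 - (tri_cos \<rho> h x)\<^sup>2)"
    by linarith
  then have "w = tri \<rho> h x 1 \<or> w = tri \<rho> h x (-1)"
    using c by (simp add: tri_def complex_eq_iff)
  then show ?thesis using that by blast
qed

text \<open>Dividing by the unit vector along the rest of the chain reduces to
  \<open>tri_complete\<close>; the bounds on \<rho> are triangle inequalities for the actual
  vectors.\<close>

lemma edge_tri: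
  assumes "finite E" "e \<notin> E" "l e > 0" "unimod (insert e E) p"
    and \<rho>: "cmod (esum l E p) = \<rho>" "\<rho> > 0" and x: "cmod (esum l (insert e E) p) = x"
  obtains s where "s = 1 \<or> s = -1" "p e = esum l E p / \<rho> * tri \<rho> (l e) x s"
    "\<bar>x - l e\<bar> \<le> \<rho>" "\<rho> \<le> x + l e"
proof -
  define u where "u = esum l E p / \<rho>"
  have u: "cmod u = 1" "esum l E p = u * \<rho>" "u \<noteq> 0" using \<rho> by (auto simp: u_def norm_divide)
  have pe: "cmod (p e) = 1" using assms by (simp add: unimod_def)
  have s: "esum l (insert e E) p = u * \<rho> + l e * p e"
    using assms(1,2) u(2) by (simp add: esum_insert)
  also have "\<dots> = u * (\<rho> + l e * (p e / u))" using u by (simp add: field_simps)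
  finally have "cmod (\<rho> + l e * (p e / u)) = x" using x u by (simp add: norm_mult)
  moreover have "cmod (p e / u) = 1" using u pe by (simp add: norm_divide)
  ultimately obtain t where t: "t = 1 \<or> t = -1" "p e / u = tri \<rho> (l e) x t"
    using tri_complete \<rho>(2) assms(3) by blast
  have n: "cmod (u * \<rho>) = \<rho>" "cmod (l e * p e) = l e"
    using u pe \<rho> assms(3) by (simp_all add: norm_mult)
  have "\<bar>x - l e\<bar> \<le> \<rho>" "\<rho> \<le> x + l e"
    using norm_triangle_ineq[of "u * \<rho>" "l e * p e"]
      norm_triangle_ineq4[of "u * \<rho> + l e * p e" "l e * p e"]
      norm_triangle_ineq4[of "u * \<rho> + l e * p e" "u * \<rho>"] x[unfolded s] n
    by auto
  moreover have "p e = u * tri \<rho> (l e) x t" using t(2) u by (simp add: field_simps)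
  ultimately show ?thesis using that t(1) unfolding u_def by blast
qed

text \<open>The orientation of the triangle may be switched at a time where the triangle is flat.\<close>

lemma joined_insert:
  assumes fin: "finite E" "e \<notin> E" and h: "l e = h" "h > 0"
    and J: "joined l E \<rho> p q"
    and \<alpha>: "continuous_on {0..1} \<alpha>" and \<rho>: "continuous_on {0..1} \<rho>"
    and band: "\<And>t. t \<in> {0..1} \<Longrightarrow> 0 \<le> \<alpha> t \<and> 0 < \<rho> t \<and> \<bar>\<alpha> t - h\<bar> \<le> \<rho> t \<and> \<rho> t \<le> \<alpha> t + h"
    and s: "s0 = 1 \<or> s0 = -1" "s1 = 1 \<or> s1 = -1"
    and switch: "s0 = s1 \<or> (0 < \<tau> \<and> \<tau> < 1 \<and> (\<rho> \<tau> = \<bar>\<alpha> \<tau> - h\<bar> \<or> \<rho> \<tau> = \<alpha> \<tau> + h))"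
    and pe: "p e = esum l E p / \<rho> 0 * tri (\<rho> 0) h (\<alpha> 0) s0"
    and qe: "q e = esum l E q / \<rho> 1 * tri (\<rho> 1) h (\<alpha> 1) s1"
  shows "joined l (insert e E) \<alpha> p q"
proof -
  from J obtain Z where Z: "lifts l E \<rho> Z" "\<forall>i\<in>E. Z 0 i = p i \<and> Z 1 i = q i"
    unfolding joined_def by blast
  \<comment> \<open>The sign jumps at \<tau>, but it multiplies \<open>y\<close>, which vanishes
    there because the triangle is flat. If the signs agree, nothing is known about \<tau> and no
    jump is made.\<close>
  define \<sigma> where "\<sigma> t = (if s0 = s1 then s0 else if t \<le> \<tau> then s0 else s1)" for t
  have \<sigma>: "\<sigma> t = 1 \<or> \<sigma> t = -1" for t using s by (auto simp: \<sigma>_def)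
  then have \<sigma>2: "(\<sigma> t)\<^sup>2 = 1" for t by (metis one_power2 power2_minus)
  define y where "y t = sqrt (1 - (tri_cos (\<rho> t) h (\<alpha> t))\<^sup>2)" for t
  have cc: "continuous_on {0..1} (\<lambda>t. tri_cos (\<rho> t) h (\<alpha> t))"
    unfolding tri_cos_def using h band by (intro continuous_intros \<alpha> \<rho>) force
  then have cy: "continuous_on {0..1} y" unfolding y_def by (intro continuous_intros)
  have csy: "continuous_on {0..1} (\<lambda>t. \<sigma> t * y t)"
  proof (cases "s0 = s1")
    case True
    then show ?thesis by (auto simp: \<sigma>_def intro!: continuous_intros cy)
  next
    case False
    then have \<tau>: "0 < \<tau>" "\<tau> < 1" and d: "\<rho> \<tau> = \<bar>\<alpha> \<tau> - h\<bar> \<or> \<rho> \<tau> = \<alpha> \<tau> + h" using switch by auto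
    have y0: "y \<tau> = 0" using tri_cos_degenerate[OF _ h(2) d] band[of \<tau>] \<tau> by (simp add: y_def)
    have "continuous_on ({0..\<tau>} \<union> {\<tau>..1}) (\<lambda>t. if t \<le> \<tau> then s0 * y t else s1 * y t)"
    proof (rule continuous_on_cases)
      show "continuous_on {0..\<tau>} (\<lambda>t. s0 * y t)" "continuous_on {\<tau>..1} (\<lambda>t. s1 * y t)"
        using \<tau> by (auto intro!: continuous_intros continuous_on_subset[OF cy])
      show "\<forall>t. t \<in> {0..\<tau>} \<and> \<not> t \<le> \<tau> \<or> t \<in> {\<tau>..1} \<and> t \<le> \<tau> \<longrightarrow> s0 * y t = s1 * y t"
      proof (intro allI impI)
        fix t assume "t \<in> {0..\<tau>} \<and> \<not> t \<le> \<tau> \<or> t \<in> {\<tau>..1} \<and> t \<le> \<tau>"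
        then have "t = \<tau>" by auto
        then show "s0 * y t = s1 * y t" using y0 by simp
      qed
    qed auto
    moreover have "{0..\<tau>} \<union> {\<tau>..1} = {0..1}" using \<tau> by auto
    moreover have "(\<lambda>t. if t \<le> \<tau> then s0 * y t else s1 * y t) = (\<lambda>t. \<sigma> t * y t)"
      using False by (auto simp: \<sigma>_def)
    ultimately show ?thesis by (simp only:)
  qed
  have ct: "continuous_on {0..1} (\<lambda>t. tri (\<rho> t) h (\<alpha> t) (\<sigma> t))"
    unfolding tri_def Complex_eq y_def[symmetric]
    by (intro csy cc continuous_on_add continuous_on_mult continuous_on_const continuous_on_of_real)
  define u where "u t = esum l E (Z t) / \<rho> t" for t
  have cu: "continuous_on {0..1} u"
    unfolding u_def esum_def using Z(1) band unfolding lifts_def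
    by (intro continuous_intros \<rho>) force+
  define W where "W t = (Z t)(e := u t * tri (\<rho> t) h (\<alpha> t) (\<sigma> t))" for t
  have WE: "esum l E (W t) = esum l E (Z t)" for t
    by (rule esum_cong) (use fin in \<open>auto simp: W_def\<close>)
  have "lifts l (insert e E) \<alpha> W"
    unfolding lifts_def
  proof (intro conjI ballI)
    fix j assume "j \<in> insert e E"
    then show "continuous_on {0..1} (\<lambda>t. W t j)"
      using Z(1) by (cases "j = e") (auto simp: W_def lifts_def intro!: continuous_intros ct cu)
  next
    fix t :: real assume t: "t \<in> {0..1}"
    have zt: "unimod E (Z t)" "cmod (esum l E (Z t)) = \<rho> t" using Z(1) t by (auto simp: lifts_def)
    have b: "0 \<le> \<alpha> t" "0 < \<rho> t" "\<bar>\<alpha> t - h\<bar> \<le> \<rho> t" "\<rho> t \<le> \<alpha> t + h" using band[OF t] by auto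
    note T = tri_props[OF b(2) h(2) b(1,3,4) \<sigma>2[of t]]
    have u1: "cmod (u t) = 1" using zt b by (simp add: u_def norm_divide)
    show "unimod (insert e E) (W t)"
      using zt(1) T(1) u1 by (auto simp: unimod_def W_def norm_mult)
    have "esum l (insert e E) (W t) = u t * (\<rho> t + h * tri (\<rho> t) h (\<alpha> t) (\<sigma> t))"
      unfolding esum_insert[OF fin] WE using b h by (simp add: W_def u_def field_simps)
    then show "cmod (esum l (insert e E) (W t)) = \<alpha> t" using T(2) u1 by (simp add: norm_mult)
  qed
  moreover have "\<forall>i\<in>insert e E. W 0 i = p i \<and> W 1 i = q i"
  proof -
    have "esum l E (Z 0) = esum l E p" "esum l E (Z 1) = esum l E q"
      using Z(2) by (auto intro: esum_cong)
    moreover have "\<sigma> 0 = s0" "\<sigma> 1 = s1" using switch by (auto simp: \<sigma>_def)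
    ultimately show ?thesis using Z(2) by (auto simp: W_def u_def pe qe)
  qed
  ultimately show ?thesis unfolding joined_def by blast
qed

text \<open>Tietze is applied to the logarithm of \<open>f\<close>, so that \<open>exp\<close> of
  the extension is positive even where \<open>lo\<close> is not; clamping to the band leaves the
  values on \<open>S\<close> unchanged.\<close>

lemma continuous_between:
  fixes lo hi f :: "real \<Rightarrow> real"
  assumes lo: "continuous_on {0..1} lo" and hi: "continuous_on {0..1} hi"
    and le: "\<And>t. t \<in> {0..1} \<Longrightarrow> lo t \<le> hi t \<and> 0 < hi t"
    and S: "closed S" "S \<subseteq> {0..1}" and f: "continuous_on S f"
    and fS: "\<And>t. t \<in> S \<Longrightarrow> 0 < f t \<and> lo t \<le> f t \<and> f t \<le> hi t"
  obtains \<rho> where "continuous_on {0..1} \<rho>" "\<And>t. t \<in> {0..1} \<Longrightarrow> 0 < \<rho> t \<and> lo t \<le> \<rho> t \<and> \<rho> t \<le> hi t"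
    "\<And>t. t \<in> S \<Longrightarrow> \<rho> t = f t"
proof -
  have "continuous_on S (\<lambda>t. ln (f t))" using fS by (intro continuous_intros f) force
  moreover have "closedin (top_of_set {0..1}) S" using S by (simp add: closed_subset)
  ultimately obtain g where g: "continuous_on {0..1} g" "\<And>t. t \<in> S \<Longrightarrow> g t = ln (f t)"
    using Tietze_unbounded[of S "\<lambda>t. ln (f t)" "{0..1}"] by metis
  show ?thesis
  proof (rule that[of "\<lambda>t. max (lo t) (min (hi t) (exp (g t)))"])
    show "continuous_on {0..1} (\<lambda>t. max (lo t) (min (hi t) (exp (g t))))"
      by (intro continuous_intros lo hi g)
    show "0 < max (lo t) (min (hi t) (exp (g t))) \<and> lo t \<le> max (lo t) (min (hi t) (exp (g t))) \<and>
        max (lo t) (min (hi t) (exp (g t))) \<le> hi t" if "t \<in> {0..1}" for t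
      using le[OF that] by (auto simp: less_max_iff_disj)
    show "max (lo t) (min (hi t) (exp (g t))) = f t" if "t \<in> S" for t
      using g(2)[OF that] fS[OF that] by auto
  qed
qed

section \<open>The induction step\<close>

lemma reach_interval:
  assumes "finite E"
  obtains m where "\<And>x. x \<in> reach l E \<longleftrightarrow> m \<le> x \<and> x \<le> sum l E"
proof
  fix x
  show "x \<in> reach l E \<longleftrightarrow> Max (insert 0 ((\<lambda>j. 2 * l j - sum l E) ` E)) \<le> x \<and> x \<le> sum l E"
    using assms by (auto simp: reach_def)
qed

text \<open>This makes the band of admissible rest distances nonempty: its top, the smaller of the
  stretched rest and the upper triangle bound, satisfies the other constraints.\<close>

lemma reach_insertD:
  assumes fin: "finite E" "e \<notin> E" and pos: "\<And>i. i \<in> insert e E \<Longrightarrow> l i > 0"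
    and x: "x \<in> reach l (insert e E)"
  shows "min (sum l E) (x + l e) \<in> reach l E" "\<bar>x - l e\<bar> \<le> min (sum l E) (x + l e)"
proof -
  have s: "sum l (insert e E) = l e + sum l E" using fin by simp
  have x0: "0 \<le> x" "x \<le> l e + sum l E" "\<And>j. j \<in> insert e E \<Longrightarrow> 2 * l j - (l e + sum l E) \<le> x"
    using x unfolding reach_def s by auto
  have "l j \<le> sum l E" if "j \<in> E" for j
    using fin pos that by (intro member_le_sum) (auto simp: less_imp_le)
  moreover have "0 \<le> sum l E" using pos by (intro sum_nonneg) (auto simp: less_imp_le)
  ultimately show "min (sum l E) (x + l e) \<in> reach l E"
    using x0 pos[of e] by (fastforce simp: reach_def min_def)
  show "\<bar>x - l e\<bar> \<le> min (sum l E) (x + l e)" using x0(1,2) x0(3)[of e] pos[of e] by auto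
qed

lemma liftableD:
  assumes "liftable l E G" "continuous_on {0..1} \<alpha>" "\<alpha> ` {0..1} \<subseteq> reach l E" "flat_ends \<epsilon> \<alpha>"
    "unimod E p" "unimod E q" "cmod (esum l E p) = \<alpha> 0" "cmod (esum l E q) = \<alpha> 1"
  shows "joined l E \<alpha> p q \<or> joined l E \<alpha> (cnj \<circ> p) q"
    "t \<in> {0..1} \<Longrightarrow> \<alpha> t \<in> G \<Longrightarrow> joined l E \<alpha> p q"
  using assms unfolding liftable_def by blast+

text \<open>Distances at which the orientation of the last triangle and the component of the rest of
  the chain can both be switched.\<close>

definition switches :: "(nat \<Rightarrow> real) \<Rightarrow> nat set \<Rightarrow> real \<Rightarrow> real set \<Rightarrow> real set" where
  "switches l E h G = {x. (\<exists>\<rho>>0. \<rho> \<in> reach l E \<inter> G \<and> \<bar>x - h\<bar> \<le> \<rho> \<and> \<rho> \<le> x + h) \<and>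
     (\<exists>\<rho>>0. \<rho> \<in> reach l E \<and> (\<rho> = \<bar>x - h\<bar> \<or> \<rho> = x + h))}"

text \<open>The top \<open>hi\<close> of the band is either the stretched length \<open>M\<close>,
  where the component can be switched since \<open>M\<close> is in \<open>G\<close>, or
  \<open>\<alpha> + h\<close>, where the triangle is flat and its orientation can be switched.
  Passing through \<open>hi\<close> at time \<epsilon>/2 settles one of the two obstructions; the
  first claim absorbs the other in a reflection, the second removes it at a later time
  \<open>t'\<close>.\<close>

lemma liftable_insert_pos:
  assumes fin: "finite E" "E \<noteq> {}" "e \<notin> E" and pos: "\<And>i. i \<in> insert e E \<Longrightarrow> l i > 0"
    and IH: "liftable l E G" and top: "sum l E \<in> G"
    and \<alpha>: "continuous_on {0..1} \<alpha>" and \<alpha>r: "\<alpha> ` {0..1} \<subseteq> reach l (insert e E)" and fl: "flat_ends \<epsilon> \<alpha>"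
    and p: "unimod (insert e E) p" "cmod (esum l (insert e E) p) = \<alpha> 0" "cmod (esum l E p) > 0"
    and q: "unimod (insert e E) q" "cmod (esum l (insert e E) q) = \<alpha> 1" "cmod (esum l E q) > 0"
  shows "joined l (insert e E) \<alpha> p q \<or> joined l (insert e E) \<alpha> (cnj \<circ> p) q"
    "\<alpha> ` {0..1} \<inter> switches l E (l e) G \<noteq> {} \<Longrightarrow> joined l (insert e E) \<alpha> p q"
proof -
  define h where "h = l e"
  have h: "h > 0" "l e = h" using pos by (auto simp: h_def)
  define M where "M = sum l E"
  have M: "M > 0" unfolding M_def using fin pos by (intro sum_pos) auto
  obtain m where m: "\<And>x. x \<in> reach l E \<longleftrightarrow> m \<le> x \<and> x \<le> M"
    using reach_interval[OF fin(1), of l] unfolding M_def by blast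
  define hi where "hi t = min M (\<alpha> t + h)" for t
  define lo where "lo t = max m \<bar>\<alpha> t - h\<bar>" for t
  have \<epsilon>: "0 < \<epsilon>" "\<epsilon> \<le> 1/2" by (fact flat_endsD[OF fl])+
  have fl0: "\<alpha> t = \<alpha> 0" if "0 \<le> t" "t \<le> \<epsilon>" for t using flat_endsD(3)[OF fl that] .
  have fl1: "\<alpha> t = \<alpha> 1" if "1 - \<epsilon> \<le> t" "t \<le> 1" for t using flat_endsD(4)[OF fl that] .
  have \<alpha>0: "0 \<le> \<alpha> t" if "t \<in> {0..1}" for t
    using subsetD[OF \<alpha>r imageI[OF that]] by (simp add: reach_def)
  have lohi: "lo t \<le> hi t \<and> 0 < hi t" if t: "t \<in> {0..1}" for t
  proof -
    have "\<alpha> t \<in> reach l (insert e E)" using \<alpha>r t by auto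
    from reach_insertD[OF fin(1,3) pos this] show ?thesis
      using m[of "hi t"] \<alpha>0[OF t] M h by (auto simp: lo_def hi_def M_def[symmetric])
  qed
  have lohi_iff: "lo t \<le> r \<and> r \<le> hi t \<longleftrightarrow> r \<in> reach l E \<and> \<bar>\<alpha> t - h\<bar> \<le> r \<and> r \<le> \<alpha> t + h" for t r
    by (auto simp: lo_def hi_def m)
  define \<rho>p where "\<rho>p = cmod (esum l E p)"
  define \<rho>q where "\<rho>q = cmod (esum l E q)"
  have up: "unimod E p" and uq: "unimod E q" using p q by (auto simp: unimod_def)
  have l0: "\<And>i. i \<in> E \<Longrightarrow> l i \<ge> 0" using pos by (auto simp: less_imp_le)
  have \<rho>pq: "\<rho>p > 0" "\<rho>q > 0" "\<rho>p \<in> reach l E" "\<rho>q \<in> reach l E"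
    using p q esum_in_reach[OF fin(1) up l0] esum_in_reach[OF fin(1) uq l0] by (auto simp: \<rho>p_def \<rho>q_def)
  obtain sp where sp: "sp = 1 \<or> sp = -1" "p e = esum l E p / \<rho>p * tri \<rho>p h (\<alpha> 0) sp"
    "\<bar>\<alpha> 0 - h\<bar> \<le> \<rho>p" "\<rho>p \<le> \<alpha> 0 + h"
    using edge_tri[of E e l p \<rho>p "\<alpha> 0"] fin p \<rho>pq h by (auto simp: \<rho>p_def)
  obtain sq where sq: "sq = 1 \<or> sq = -1" "q e = esum l E q / \<rho>q * tri \<rho>q h (\<alpha> 1) sq"
    "\<bar>\<alpha> 1 - h\<bar> \<le> \<rho>q" "\<rho>q \<le> \<alpha> 1 + h"
    using edge_tri[of E e l q \<rho>q "\<alpha> 1"] fin q \<rho>pq h by (auto simp: \<rho>q_def)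
  have cp: "(cnj \<circ> p) e = esum l E (cnj \<circ> p) / \<rho>p * tri \<rho>p h (\<alpha> 0) (- sp)"
    unfolding esum_cnj using sp(2) by (simp add: cnj_tri)

  \<comment> \<open>A path inside the band through \<open>hi\<close> at \<epsilon>/2 and through a
    chosen value \<open>r\<close> at \<open>t'\<close>. The range of \<open>t'\<close> keeps it away
    from \<epsilon>/2 and from both end stretches, so that the prescribed values never
    clash.\<close>
  have bandpath: "\<exists>\<rho>. continuous_on {0..1} \<rho> \<and> \<rho> ` {0..1} \<subseteq> reach l E \<and> flat_ends (\<epsilon>/4) \<rho> \<and>
      \<rho> 0 = \<rho>p \<and> \<rho> 1 = \<rho>q \<and> \<rho> (\<epsilon>/2) = hi 0 \<and> \<rho> t' = r \<and>
      (\<forall>t\<in>{0..1}. 0 \<le> \<alpha> t \<and> 0 < \<rho> t \<and> \<bar>\<alpha> t - h\<bar> \<le> \<rho> t \<and> \<rho> t \<le> \<alpha> t + h)"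
    if t': "t' \<in> {3*\<epsilon>/4..1-\<epsilon>/2}" and r: "0 < r" "lo t' \<le> r \<and> r \<le> hi t'" for t' r
  proof -
    define f where "f t = (if t \<le> \<epsilon>/4 then \<rho>p else if t \<ge> 1 - \<epsilon>/4 then \<rho>q else if t = t' then r else hi 0)" for t
    define S where "S = {0..\<epsilon>/4} \<union> {1-\<epsilon>/4..1} \<union> {t'} \<union> {\<epsilon>/2}"
    have "continuous_on S f"
      unfolding S_def
    proof (intro continuous_on_closed_Un)
      show "continuous_on {0..\<epsilon>/4} f"
        by (rule continuous_on_eq[where f = "\<lambda>_. \<rho>p"]) (auto simp: f_def)
      show "continuous_on {1-\<epsilon>/4..1} f"
        by (rule continuous_on_eq[where f = "\<lambda>_. \<rho>q"]) (use \<epsilon> in \<open>auto simp: f_def\<close>)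
    qed (auto intro!: closed_insert closed_Un)
    moreover have "closed S" "S \<subseteq> {0..1}" using \<epsilon> t' by (auto simp: S_def intro!: closed_insert closed_Un)
    moreover have "0 < f t \<and> lo t \<le> f t \<and> f t \<le> hi t" if t: "t \<in> S" for t
    proof -
      have "lo t = lo 0 \<and> hi t = hi 0" if "0 \<le> t" "t \<le> \<epsilon>/2"
        using fl0[of t] that \<epsilon> by (auto simp: lo_def hi_def)
      moreover have "lo t = lo 1 \<and> hi t = hi 1" if "1 - \<epsilon>/4 \<le> t" "t \<le> 1"
        using fl1[of t] that \<epsilon> by (auto simp: lo_def hi_def)
      moreover have "lo 0 \<le> \<rho>p \<and> \<rho>p \<le> hi 0" "lo 1 \<le> \<rho>q \<and> \<rho>q \<le> hi 1"
        using lohi_iff \<rho>pq sp sq by auto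
      ultimately show ?thesis
        using t t' r \<epsilon> \<rho>pq lohi[of 0] unfolding S_def f_def by auto
    qed
    moreover have "continuous_on {0..1} lo" "continuous_on {0..1} hi"
      unfolding lo_def hi_def by (intro continuous_intros \<alpha>)+
    ultimately obtain \<rho> where \<rho>: "continuous_on {0..1} \<rho>"
      "\<And>t. t \<in> {0..1} \<Longrightarrow> 0 < \<rho> t \<and> lo t \<le> \<rho> t \<and> \<rho> t \<le> hi t" "\<And>t. t \<in> S \<Longrightarrow> \<rho> t = f t"
      using continuous_between[of lo hi S f] lohi by blast
    have v: "\<rho> t = \<rho>p" if "0 \<le> t" "t \<le> \<epsilon>/4" for t
      using \<rho>(3)[of t] that by (auto simp: S_def f_def)
    have w: "\<rho> t = \<rho>q" if "1 - \<epsilon>/4 \<le> t" "t \<le> 1" for t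
      using \<rho>(3)[of t] that \<epsilon> by (auto simp: S_def f_def)
    have "flat_ends (\<epsilon>/4) \<rho>" unfolding flat_ends_def
    proof (intro conjI ballI)
      show "\<rho> t = \<rho> 0" if "t \<in> {0..\<epsilon>/4}" for t using v[of t] v[of 0] that \<epsilon> by simp
      show "\<rho> t = \<rho> 1" if "t \<in> {1-\<epsilon>/4..1}" for t using w[of t] w[of 1] that \<epsilon> by simp
    qed (use \<epsilon> in auto)
    moreover have "\<rho> (\<epsilon>/2) = hi 0" "\<rho> t' = r"
      using \<rho>(3)[of "\<epsilon>/2"] \<rho>(3)[of t'] t' \<epsilon> by (auto simp: S_def f_def)
    moreover have "\<rho> t \<in> reach l E \<and> \<bar>\<alpha> t - h\<bar> \<le> \<rho> t \<and> \<rho> t \<le> \<alpha> t + h \<and> 0 < \<rho> t" if "t \<in> {0..1}" for t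
      using \<rho>(2)[OF that] lohi_iff by blast
    ultimately show ?thesis
      using \<rho>(1) v[of 0] w[of 1] \<epsilon> \<alpha>0 by (intro exI[of _ \<rho>]) auto
  qed

  have hi0: "hi 0 = M \<or> hi 0 = \<alpha> 0 + h" by (auto simp: hi_def)
  have half: "\<alpha> (\<epsilon>/2) = \<alpha> 0" using fl0[of "\<epsilon>/2"] \<epsilon> by simp
  have \<tau>: "0 < \<epsilon>/2" "\<epsilon>/2 < 1" "\<epsilon>/2 \<in> {0..1}" using \<epsilon> by auto

  show "joined l (insert e E) \<alpha> p q \<or> joined l (insert e E) \<alpha> (cnj \<circ> p) q"
  proof -
    \<comment> \<open>The second prescribed point is an arbitrary admissible one; only the passage
      through \<open>hi\<close> is used.\<close>
    obtain \<rho> where \<rho>: "continuous_on {0..1} \<rho>" "\<rho> ` {0..1} \<subseteq> reach l E" "flat_ends (\<epsilon>/4) \<rho>"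
      "\<rho> 0 = \<rho>p" "\<rho> 1 = \<rho>q" "\<rho> (\<epsilon>/2) = hi 0"
      "\<And>t. t \<in> {0..1} \<Longrightarrow> 0 \<le> \<alpha> t \<and> 0 < \<rho> t \<and> \<bar>\<alpha> t - h\<bar> \<le> \<rho> t \<and> \<rho> t \<le> \<alpha> t + h"
      using bandpath[of "3*\<epsilon>/4" "hi (3*\<epsilon>/4)"] lohi[of "3*\<epsilon>/4"] \<epsilon> by auto
    have J: "joined l (insert e E) \<alpha> p' q"
      if "joined l E \<rho> p' q" "s = 1 \<or> s = -1" "p' e = esum l E p' / \<rho>p * tri \<rho>p h (\<alpha> 0) s"
        "s = sq \<or> \<rho> (\<epsilon>/2) = \<alpha> (\<epsilon>/2) + h" for p' s
      using joined_insert[OF fin(1,3) h(2,1) that(1) \<alpha> \<rho>(1) \<rho>(7) that(2) sq(1), of "\<epsilon>/2"]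
        that(3,4) sq(2) \<tau> \<rho>(4,5) by auto
    have L: "joined l E \<rho> p' q \<or> joined l E \<rho> (cnj \<circ> p') q" "\<rho> (\<epsilon>/2) \<in> G \<Longrightarrow> joined l E \<rho> p' q"
      if "unimod E p'" "cmod (esum l E p') = \<rho>p" for p'
      using liftableD(1)[OF IH \<rho>(1-3) that(1) uq] liftableD(2)[OF IH \<rho>(1-3) that(1) uq, of "\<epsilon>/2"] that(2) \<tau>(3) \<rho>(4,5) by (auto simp: \<rho>q_def)
    have Lp: "joined l E \<rho> p q \<or> joined l E \<rho> (cnj \<circ> p) q"
      using L(1)[OF up] by (simp add: \<rho>p_def)
    show ?thesis using hi0
    proof
      assume "hi 0 = M"
      then have G: "\<rho> (\<epsilon>/2) \<in> G" using top \<rho>(6) by (simp add: M_def)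
      \<comment> \<open>At \<open>M\<close> the component is free: both \<open>p\<close> and its
        reflection reach \<open>q\<close> on the rest, and the one whose triangle is oriented like
        that of \<open>q\<close> is taken.\<close>
      have j: "joined l E \<rho> p q" "joined l E \<rho> (cnj \<circ> p) q"
        using L(2)[OF _ _ G] up by (simp_all add: \<rho>p_def unimod_cnj esum_cnj)
      show ?thesis
      proof (cases "sp = sq")
        case True
        then show ?thesis using J[OF j(1) sp(1,2)] by simp
      next
        case False
        then have "- sp = sq" using sp(1) sq(1) by auto
        then show ?thesis using sq(1) by (intro disjI2[OF J[OF j(2) _ cp disjI1]]) auto
      qed
    next
      assume "hi 0 = \<alpha> 0 + h"
      \<comment> \<open>Here the orientation is free, so whichever of \<open>p\<close> and its
        reflection lifts on the rest also lifts with edge \<open>e\<close>.\<close>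
      then have sw: "\<rho> (\<epsilon>/2) = \<alpha> (\<epsilon>/2) + h" using \<rho>(6) half by simp
      from Lp show ?thesis
      proof
        assume j: "joined l E \<rho> p q"
        then show ?thesis using J[OF j sp(1,2)] sw by simp
      next
        assume j: "joined l E \<rho> (cnj \<circ> p) q"
        then show ?thesis using sp(1) by (intro disjI2[OF J[OF j _ cp disjI2[OF sw]]]) auto
      qed
    qed
  qed

  show "joined l (insert e E) \<alpha> p q" if "\<alpha> ` {0..1} \<inter> switches l E (l e) G \<noteq> {}"
  proof -
    from that obtain t0 where t0: "t0 \<in> {0..1}" "\<alpha> t0 \<in> switches l E h G"
      unfolding h_def by blast
    \<comment> \<open>\<open>t0\<close> is clamped into the range allowed by
      \<open>bandpath\<close>; the value of \<alpha> is kept, since \<alpha> is constant within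
      \<epsilon> of either end.\<close>
    define t' where "t' = max (3*\<epsilon>/4) (min (1-\<epsilon>/2) t0)"
    have "\<alpha> t' = \<alpha> t0"
    proof (cases "t0 < 3*\<epsilon>/4")
      case True
      then have "t' = 3*\<epsilon>/4" using \<epsilon> by (auto simp: t'_def)
      then show ?thesis using fl0[of t0] fl0[of t'] True t0 \<epsilon> by auto
    next
      case False
      show ?thesis
      proof (cases "t0 > 1 - \<epsilon>/2")
        case True
        then have "t' = 1 - \<epsilon>/2" using \<epsilon> by (auto simp: t'_def)
        then show ?thesis using fl1[of t0] fl1[of t'] True t0 \<epsilon> by auto
      qed (use False in \<open>auto simp: t'_def\<close>)
    qed
    have t': "t' \<in> {3*\<epsilon>/4..1-\<epsilon>/2}" "0 < t'" "t' < 1" "t' \<in> {0..1}" using \<epsilon> by (auto simp: t'_def)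
    obtain rc rs where rc: "rc > 0" "rc \<in> reach l E" "rc \<in> G" "\<bar>\<alpha> t' - h\<bar> \<le> rc" "rc \<le> \<alpha> t' + h"
      and rs: "rs > 0" "rs \<in> reach l E" "rs = \<bar>\<alpha> t' - h\<bar> \<or> rs = \<alpha> t' + h"
      using t0(2) unfolding switches_def \<open>\<alpha> t' = \<alpha> t0\<close> by auto
    \<comment> \<open>At \<open>t'\<close> the other switch is made: a flat triangle if \<epsilon>/2
      was spent on \<open>M\<close>, a value in \<open>G\<close> if it was spent on a flat
      triangle.\<close>
    define r where "r = (if hi 0 = M then rs else rc)"
    have "0 < r" "lo t' \<le> r \<and> r \<le> hi t'"
      using rc rs \<alpha>0[OF t'(4)] h unfolding lohi_iff by (auto simp: r_def)
    then obtain \<rho> where \<rho>: "continuous_on {0..1} \<rho>" "\<rho> ` {0..1} \<subseteq> reach l E" "flat_ends (\<epsilon>/4) \<rho>"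
      "\<rho> 0 = \<rho>p" "\<rho> 1 = \<rho>q" "\<rho> (\<epsilon>/2) = hi 0" "\<rho> t' = r"
      "\<And>t. t \<in> {0..1} \<Longrightarrow> 0 \<le> \<alpha> t \<and> 0 < \<rho> t \<and> \<bar>\<alpha> t - h\<bar> \<le> \<rho> t \<and> \<rho> t \<le> \<alpha> t + h"
      using bandpath[OF t'(1), of r] by auto
    define tc where "tc = (if hi 0 = M then \<epsilon>/2 else t')"
    define ts where "ts = (if hi 0 = M then t' else \<epsilon>/2)"
    have tc: "tc \<in> {0..1}" "\<rho> tc \<in> G"
      using \<tau>(3) t'(4) \<rho>(6,7) rc(3) top by (auto simp: r_def M_def tc_def)
    have ts: "0 < ts" "ts < 1" "\<rho> ts = \<bar>\<alpha> ts - h\<bar> \<or> \<rho> ts = \<alpha> ts + h"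
      using \<tau>(1,2) t'(2,3) \<rho>(6,7) rs(3) hi0 half by (auto simp: r_def ts_def)
    have j: "joined l E \<rho> p q"
      using liftableD(2)[OF IH \<rho>(1-3) up uq _ _ tc] \<rho>(4,5) by (simp add: \<rho>p_def \<rho>q_def)
    show "joined l (insert e E) \<alpha> p q"
      using joined_insert[OF fin(1,3) h(2,1) j \<alpha> \<rho>(1) \<rho>(8) sp(1) sq(1), of ts] ts sp(2) sq(2) \<rho>(4,5)
      by auto
  qed
qed

text \<open>End configurations whose rest closes up are avoided by spending part of the constant end
  stretches on the moves of \<open>move_off_zero\<close>.\<close>

lemma liftable_insert:
  assumes fin: "finite E" "E \<noteq> {}" "e \<notin> E" and pos: "\<And>i. i \<in> insert e E \<Longrightarrow> l i > 0"
    and IH: "liftable l E G" and top: "sum l E \<in> G"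
    and G': "\<And>x. x \<in> reach l (insert e E) \<Longrightarrow> x \<in> G' \<Longrightarrow> x \<in> switches l E (l e) G"
  shows "liftable l (insert e E) G'"
  unfolding liftable_def
proof (intro allI impI)
  fix \<alpha> p q \<epsilon>
  assume \<alpha>: "continuous_on {0..1} \<alpha>" "\<alpha> ` {0..1} \<subseteq> reach l (insert e E)" and fl: "flat_ends \<epsilon> \<alpha>"
    and p: "unimod (insert e E) p" and q: "unimod (insert e E) q"
    and p0: "cmod (esum l (insert e E) p) = \<alpha> 0" and q1: "cmod (esum l (insert e E) q) = \<alpha> 1"
  obtain p' where p': "unimod (insert e E) p'" "cmod (esum l (insert e E) p') = \<alpha> 0"
    "joined l (insert e E) (\<lambda>_. \<alpha> 0) p p'" "cmod (esum l E p') > 0"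
    using move_off_zero[OF fin pos p p0] by blast
  obtain q' where q': "unimod (insert e E) q'" "cmod (esum l (insert e E) q') = \<alpha> 1"
    "joined l (insert e E) (\<lambda>_. \<alpha> 1) q q'" "cmod (esum l E q') > 0"
    using move_off_zero[OF fin pos q q1] by blast
  note L = liftable_insert_pos[OF fin pos IH top \<alpha> fl p'(1,2,4) q'(1,2,4)]
  have 1: "joined l (insert e E) \<alpha> p q" if "joined l (insert e E) \<alpha> p' q'"
    by (rule joined_append[OF fl joined_prepend[OF fl p'(3) that] q'(3)])
  have 2: "joined l (insert e E) \<alpha> (cnj \<circ> p) q" if "joined l (insert e E) \<alpha> (cnj \<circ> p') q'"
    by (rule joined_append[OF fl joined_prepend[OF fl joined_cnj[OF p'(3)] that] q'(3)])
  have "\<alpha> ` {0..1} \<inter> switches l E (l e) G \<noteq> {}" if "\<alpha> ` {0..1} \<inter> G' \<noteq> {}"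
    using that \<alpha>(2) G' by blast
  then show "(joined l (insert e E) \<alpha> p q \<or> joined l (insert e E) \<alpha> (cnj \<circ> p) q) \<and>
     (\<alpha> ` {0..1} \<inter> G' \<noteq> {} \<longrightarrow> joined l (insert e E) \<alpha> p q)"
    using L 1 2 by blast
qed

section \<open>Chains whose two longest edges can be folded\<close>

definition folded :: "(nat \<Rightarrow> real) \<Rightarrow> nat set \<Rightarrow> nat \<Rightarrow> nat \<Rightarrow> real set" where
  "folded l E u v = {x. \<exists>z. unimod E z \<and> cmod (esum l E z) = x \<and> (z u = z v \<or> z u = - z v)}"

text \<open>The fully stretched chain is folded; this supplies the condition
  \<open>sum l E \<in> G\<close> of the induction step.\<close>

lemma sum_in_folded:
  assumes "\<And>i. i \<in> E \<Longrightarrow> l i \<ge> 0"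
  shows "sum l E \<in> folded l E u v"
proof -
  have "esum l E (\<lambda>_. 1) = of_real (sum l E)" by (simp add: esum_def)
  moreover have "0 \<le> sum l E" by (rule sum_nonneg) (fact assms)
  ultimately have "cmod (esum l E (\<lambda>_. 1)) = sum l E" by (simp del: of_real_sum)
  then show ?thesis unfolding folded_def by (intro CollectI exI[of _ "\<lambda>_. 1"]) (simp add: unimod_def)
qed

lemma sum_in_reach:
  assumes "finite E" "\<And>i. i \<in> E \<Longrightarrow> l i \<ge> 0"
  shows "sum l E \<in> reach l E"
proof -
  have "l j \<le> sum l E" if "j \<in> E" for j using assms that by (intro member_le_sum) auto
  moreover have "0 \<le> sum l E" by (rule sum_nonneg) (fact assms)
  ultimately show ?thesis by (fastforce simp: reach_def)
qed

text \<open>A parallel pair acts as one edge of length \<open>l u + l v\<close>, whose polygon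
  inequality is the first alternative; an antiparallel pair acts as one of length
  \<open>l u - l v\<close>, which shortens the total length by \<open>2 * l v\<close>.\<close>

lemma folded_bounds:
  assumes fin: "finite E" and uv: "u \<in> E" "v \<in> E" "u \<noteq> v" and nn: "\<And>i. i \<in> E \<Longrightarrow> l i \<ge> 0"
    and le: "l v \<le> l u" and x: "x \<in> folded l E u v"
  shows "2 * (l u + l v) - sum l E \<le> x \<or> x \<le> sum l E - 2 * l v"
proof -
  obtain z where z: "unimod E z" "cmod (esum l E z) = x" "z u = z v \<or> z u = - z v"
    using x by (auto simp: folded_def)
  define F where "F = E - {u, v}"
  have E: "E = insert u (insert v F)" using uv by (auto simp: F_def)
  have F: "finite F" "u \<notin> insert v F" "v \<notin> F" using fin uv by (auto simp: F_def)
  have s: "sum l E = l u + l v + sum l F" unfolding E using F by simp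
  have es: "esum l E z = esum l F z + (complex_of_real (l v) * z v + complex_of_real (l u) * z u)"
    unfolding E using F by (simp add: esum_insert)
  have Fle: "cmod (esum l F z) \<le> sum l F"
    by (rule cmod_esum_le) (use z nn in \<open>auto simp: unimod_def F_def\<close>)
  have zv: "cmod (z v) = 1" using z uv by (auto simp: unimod_def)
  have lu: "l u \<ge> 0" "l v \<ge> 0" using nn uv by auto
  from z(3) show ?thesis
  proof
    assume "z u = z v"
    then have "complex_of_real (l v) * z v + complex_of_real (l u) * z u = of_real (l u + l v) * z v"
      by (simp add: algebra_simps)
    then have n: "cmod (complex_of_real (l v) * z v + complex_of_real (l u) * z u) = l u + l v"
      using zv lu by (simp add: norm_mult del: of_real_add)
    show ?thesis
      using norm_triangle_ineq4[of "esum l E z" "esum l F z"] Fle z(2) n s unfolding es by auto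
  next
    assume "z u = - z v"
    then have "complex_of_real (l v) * z v + complex_of_real (l u) * z u = of_real (l v - l u) * z v"
      by (simp add: algebra_simps)
    then have n: "cmod (complex_of_real (l v) * z v + complex_of_real (l u) * z u) = l u - l v"
      using zv le by (simp add: norm_mult del: of_real_diff)
    show ?thesis
      using norm_triangle_ineq[of "esum l F z" "complex_of_real (l v) * z v + complex_of_real (l u) * z u"]
        Fle z(2) n s unfolding es by auto
  qed
qed

section \<open>Chains of one, two and three edges\<close>

lemma liftable_one:
  assumes "l v > 0"
  shows "liftable l {v} UNIV"
proof -
  have "joined l {v} \<alpha> p q" if a: "\<alpha> ` {0..1} \<subseteq> reach l {v}" and pq: "unimod {v} p" "unimod {v} q" for \<alpha> p q
  proof -
    obtain a where a': "p v * cis a = q v" using pq unit_rotation[of "p v" "q v"] by (auto simp: unimod_def)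
    \<comment> \<open>A single edge realises only \<open>l v\<close>, so \<alpha> is constant and a
      rotation suffices.\<close>
    have "\<alpha> t = l v" if "t \<in> {0..1}" for t
      using subsetD[OF a imageI[OF that]] by (simp add: reach_def)
    then have "lifts l {v} \<alpha> (\<lambda>t _. p v * cis (t * a))"
      using pq assms by (auto simp: lifts_def unimod_def esum_def norm_mult intro!: continuous_intros)
    then show ?thesis unfolding joined_def using a' by (intro exI[of _ "\<lambda>t _. p v * cis (t * a)"]) auto
  qed
  then show ?thesis unfolding liftable_def by blast
qed

text \<open>Edge \<open>u\<close> is peeled off. The rest is one edge, which lifts without
  reflection, so only a flat triangle is required, and two folded edges form one.\<close>

lemma liftable_two:
  assumes uv: "u \<noteq> v" and l: "l u > 0" "l v > 0" "l v \<le> l u"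
  shows "liftable l {u, v} (folded l {u, v} u v)"
proof (rule liftable_insert[where G = UNIV])
  fix x assume r: "x \<in> reach l {u, v}" and x: "x \<in> folded l {u, v} u v"
  have "l v \<in> reach l {v}" "\<bar>x - l u\<bar> \<le> l v" "l v \<le> x + l u"
    using r l uv by (auto simp: reach_def)
  moreover have "l v = \<bar>x - l u\<bar> \<or> l v = x + l u"
  proof -
    obtain z where z: "cmod (z v) = 1" "cmod (of_real (l u) * z u + of_real (l v) * z v) = x"
      "z u = z v \<or> z u = - z v"
      using x uv by (auto simp: folded_def unimod_def esum_def)
    from z(3) show ?thesis
    proof
      assume "z u = z v"
      then have "of_real (l u) * z u + of_real (l v) * z v = of_real (l u + l v) * z v"
        by (simp add: algebra_simps)
      then have "x = l u + l v" using z(1,2) l by (simp add: norm_mult del: of_real_add)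
      then show ?thesis using l by simp
    next
      assume "z u = - z v"
      then have "of_real (l u) * z u + of_real (l v) * z v = of_real (l v - l u) * z v"
        by (simp add: algebra_simps)
      then have "x = l u - l v" using z(1,2) l by (simp add: norm_mult del: of_real_diff)
      then show ?thesis using l by simp
    qed
  qed
  ultimately show "x \<in> switches l {v} (l u) UNIV"
    unfolding switches_def using l by blast
qed (use uv l liftable_one in auto)

text \<open>With two equal longest edges, peeling off the third would force the end distance of the
  remaining pair through \<open>0\<close>, so a longest one is peeled off instead.\<close>

lemma liftable_three_isosceles:
  assumes d: "u \<noteq> v" "w \<noteq> u" "w \<noteq> v" and l: "l v = l u" "l w \<le> l u" "l w > 0"
  shows "liftable l {u, v, w} (folded l {u, v, w} u v)"
proof (rule liftable_insert[where G = "folded l {v, w} v w"])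
  show "liftable l {v, w} (folded l {v, w} v w)" by (rule liftable_two) (use d l in auto)
  show "sum l {v, w} \<in> folded l {v, w} v w" by (rule sum_in_folded) (use l in auto)
  fix x assume r: "x \<in> reach l {u, v, w}" and x: "x \<in> folded l {u, v, w} u v"
  have x0: "0 \<le> x" "x \<le> 2 * l u + l w" using r d l by (auto simp: reach_def)
  obtain z where z: "unimod {u, v, w} z" "cmod (esum l {u, v, w} z) = x" "z u = z v \<or> z u = - z v"
    using x by (auto simp: folded_def)
  have es: "esum l {u, v, w} z = of_real (l u) * (z u + z v) + of_real (l w) * z w"
    using d l by (simp add: esum_def algebra_simps)
  have un: "cmod (z v) = 1" "cmod (z w) = 1" using z by (auto simp: unimod_def)
  \<comment> \<open>Parallel \<open>u\<close> and \<open>v\<close> give the second alternative;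
    antiparallel ones cancel and leave \<open>l w\<close>.\<close>
  have D: "x = l w \<or> 2 * l u - l w \<le> x"
    using z(3)
  proof
    assume "z u = z v"
    then have "cmod (of_real (l u) * (z u + z v)) = 2 * l u" using un l by (simp add: norm_mult)
    moreover have "cmod (of_real (l w) * z w) = l w" using un l by (simp add: norm_mult)
    ultimately show ?thesis
      using norm_triangle_ineq4[of "esum l {u, v, w} z" "of_real (l w) * z w"] z(2) unfolding es by simp
  next
    assume "z u = - z v"
    then show ?thesis using z(2) un l unfolding es by (simp add: norm_mult)
  qed
  have R: "y \<in> reach l {v, w} \<longleftrightarrow> 0 \<le> y \<and> y \<le> l u + l w \<and> l u - l w \<le> y" for y
    using d l by (auto simp: reach_def)
  \<comment> \<open>The stretched rest switches the component; \<open>D\<close> yields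
    \<open>l w \<le> x\<close>, hence \<open>\<rho> \<le> x + l u\<close>.\<close>
  have "\<exists>\<rho>>0. \<rho> \<in> reach l {v, w} \<inter> folded l {v, w} v w \<and> \<bar>x - l u\<bar> \<le> \<rho> \<and> \<rho> \<le> x + l u"
  proof (intro exI[of _ "sum l {v, w}"] conjI IntI)
    show "sum l {v, w} \<in> folded l {v, w} v w" by (rule sum_in_folded) (use l in auto)
    show "sum l {v, w} \<in> reach l {v, w}" by (rule sum_in_reach) (use l in auto)
  qed (use d l x0 D in auto)
  moreover have "\<exists>\<rho>>0. \<rho> \<in> reach l {v, w} \<and> (\<rho> = \<bar>x - l u\<bar> \<or> \<rho> = x + l u)"
  proof (cases "x \<le> l w")
    case True
    then show ?thesis unfolding R using x0 l by (intro exI[of _ "x + l u"]) auto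
  next
    case False
    \<comment> \<open>\<open>l w < x\<close> and \<open>D\<close> together give
      \<open>l u < x\<close>, so this \<rho> is positive.\<close>
    then show ?thesis unfolding R using x0 l D by (intro exI[of _ "\<bar>x - l u\<bar>"]) auto
  qed
  ultimately show "x \<in> switches l {v, w} (l u) (folded l {v, w} v w)"
    unfolding switches_def by blast
qed (use d l in auto)

text \<open>A folded configuration of the longer chain restricts to a folded one of
  \<open>E\<close>, whose end distance switches the component. If the rest closes up, this distance
  is 0; \<open>ex\<close> then guarantees a third edge by which to open it. For the orientation, one
  of the flat triangles with \<rho> = x + h or \<rho> = x - h is realisable.\<close>

lemma liftable_insert_folded:
  assumes fin: "finite E" and uv: "u \<in> E" "v \<in> E" "u \<noteq> v" and e: "e \<notin> E"
    and pos: "\<And>i. i \<in> insert e E \<Longrightarrow> l i > 0"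
    and le: "l v \<le> l u" "\<And>i. i \<in> E \<Longrightarrow> l i \<le> l u" "l e \<le> l v"
    and IH: "liftable l E (folded l E u v)"
    and ex: "l v < l u \<or> E \<noteq> {u, v}"
  shows "liftable l (insert e E) (folded l (insert e E) u v)"
proof (rule liftable_insert[where G = "folded l E u v"])
  have nn: "\<And>i. i \<in> E \<Longrightarrow> l i \<ge> 0" using pos by (auto simp: less_imp_le)
  show "sum l E \<in> folded l E u v" by (rule sum_in_folded) (fact nn)
  fix x assume r: "x \<in> reach l (insert e E)" and x: "x \<in> folded l (insert e E) u v"
  define h where "h = l e"
  have h: "h > 0" "h \<le> l v" using pos le by (auto simp: h_def)
  have s: "sum l (insert e E) = h + sum l E" using fin e by (simp add: h_def)
  have x0: "0 \<le> x" using r by (simp add: reach_def)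
  have suv: "l u + l v \<le> sum l E"
    using sum_mono2[of E "{u, v}" l] fin uv nn by auto
  obtain z where z: "unimod (insert e E) z" "cmod (esum l (insert e E) z) = x" "z u = z v \<or> z u = - z v"
    using x by (auto simp: folded_def)
  have zE: "unimod E z" using z by (simp add: unimod_def)
  have "\<exists>\<rho>>0. \<rho> \<in> reach l E \<inter> folded l E u v \<and> \<bar>x - h\<bar> \<le> \<rho> \<and> \<rho> \<le> x + h"
  proof (cases "esum l E z = 0")
    case False
    have "\<bar>x - h\<bar> \<le> cmod (esum l E z)" "cmod (esum l E z) \<le> x + h"
      using edge_tri[OF fin e _ z(1) refl _ z(2)] False h by (auto simp: h_def)
    moreover have "cmod (esum l E z) \<in> reach l E" by (rule esum_in_reach[OF fin zE nn])
    moreover have "cmod (esum l E z) \<in> folded l E u v" using zE z(3) by (auto simp: folded_def)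
    ultimately show ?thesis using False by (intro exI[of _ "cmod (esum l E z)"]) auto
  next
    case True
    have xh: "x = h" using z h by (simp add: esum_insert[OF fin e] True norm_mult unimod_def h_def)
    have "E \<noteq> {u, v}"
    proof
      assume E: "E = {u, v}"
      then have "cmod (of_real (l u) * z u) = cmod (of_real (l v) * z v)"
        using True uv by (simp add: esum_def add_eq_0_iff)
      then have "l u = l v" using zE uv nn by (simp add: unimod_def norm_mult)
      then show False using ex E by simp
    qed
    then obtain w where w: "w \<in> E" "w \<noteq> u" "w \<noteq> v" using uv by blast
    have lw: "l w > 0" using pos w by simp
    \<comment> \<open>The opened rest will have length \<open>l w * \<tau>\<close>, at most
      \<open>h\<close>, which fits a triangle with \<open>x = h\<close>. Since
      \<open>tri 1 1 \<tau> 1\<close> has distance \<tau> from -1, its negative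
      \<open>\<zeta>\<close> has distance \<tau> from 1. Only \<open>w\<close> turns, so
      \<open>u\<close> and \<open>v\<close> stay folded.\<close>
    define \<tau> where "\<tau> = min 1 (h / l w)"
    have \<tau>: "0 < \<tau>" "\<tau> \<le> 1" "l w * \<tau> \<le> h" using lw h by (auto simp: \<tau>_def min_def field_simps)
    define \<zeta> where "\<zeta> = - tri 1 1 \<tau> 1"
    have \<zeta>: "cmod \<zeta> = 1" "cmod (\<zeta> - 1) = \<tau>"
      using tri_props[of 1 1 \<tau> 1] \<tau> by (simp_all add: \<zeta>_def norm_minus_commute)
    define y where "y = z(w := \<zeta> * z w)"
    have yE: "unimod E y" using zE w \<zeta> by (auto simp: y_def unimod_def norm_mult)
    have "esum l E y = complex_of_real (l w) * z w * (\<zeta> - 1)"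
    proof -
      have E: "E = insert w (E - {w})" using w by auto
      have 1: "esum l E f = esum l (E - {w}) f + complex_of_real (l w) * f w" for f
        by (subst E, subst esum_insert) (use fin in auto)
      have "esum l (E - {w}) y = esum l (E - {w}) z" by (rule esum_cong) (auto simp: y_def)
      then show ?thesis using 1[of y] 1[of z] True by (simp add: y_def algebra_simps)
    qed
    then have ny: "cmod (esum l E y) = l w * \<tau>" using \<zeta> zE w lw by (simp add: norm_mult unimod_def)
    have "l w * \<tau> \<in> reach l E" using esum_in_reach[of E y l] fin yE nn ny by simp
    moreover have "y u = y v \<or> y u = - y v" using z(3) w by (simp add: y_def)
    then have "l w * \<tau> \<in> folded l E u v" using yE ny by (auto simp: folded_def)
    ultimately show ?thesis using lw \<tau> h by (intro exI[of _ "l w * \<tau>"]) (auto simp: xh)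
  qed
  moreover have "\<exists>\<rho>>0. \<rho> \<in> reach l E \<and> (\<rho> = \<bar>x - h\<bar> \<or> \<rho> = x + h)"
  proof (cases "x + h \<le> sum l E")
    case True
    then have "x + h \<in> reach l E"
      using reach_insertD(1)[OF fin e pos r] by (simp add: h_def min_absorb2)
    then show ?thesis using x0 h by (intro exI[of _ "x + h"]) auto
  next
    case False
    have lb: "\<bar>x - h\<bar> \<le> sum l E" using reach_insertD(2)[OF fin e pos r] by (simp add: h_def)
    have "2 * (l u + l v) - (h + sum l E) \<le> x \<or> x \<le> h + sum l E - 2 * l v"
      using folded_bounds[of "insert e E" u v l x] fin uv pos le x s by (force simp: less_imp_le)
    \<comment> \<open>The second alternative would give \<open>x + h \<le> sum l E\<close>, because
      \<open>h \<le> l v\<close>.\<close>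
    then have b: "2 * (l u + l v) - (h + sum l E) \<le> x" using False h by linarith
    have xh: "x - h > 0" using False suv h le by linarith
    have "2 * l j - sum l E \<le> x - h" if "j \<in> E" for j
    proof -
      have "2 * l u + 2 * l v - h - sum l E \<le> x" using b by simp
      then show ?thesis using h(2) le(2)[OF that] by linarith
    qed
    then have "\<bar>x - h\<bar> \<in> reach l E" using xh lb by (simp add: reach_def)
    then show ?thesis using xh by (intro exI[of _ "\<bar>x - h\<bar>"]) auto
  qed
  ultimately show "x \<in> switches l E (l e) (folded l E u v)"
    unfolding switches_def h_def by blast
qed (use fin uv e pos IH in auto)

text \<open>Induction on the number of edges, peeling off any edge other than \<open>u\<close> and
  \<open>v\<close>. The exceptional case is a chain of three edges with
  \<open>l u = l v\<close>.\<close>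

lemma liftable_folded:
  assumes "finite E" "u \<in> E" "v \<in> E" "u \<noteq> v" "\<And>i. i \<in> E \<Longrightarrow> l i > 0"
    "\<And>i. i \<in> E \<Longrightarrow> l i \<le> l u" "\<And>i. i \<in> E - {u} \<Longrightarrow> l i \<le> l v"
  shows "liftable l E (folded l E u v)"
  using assms
proof (induction "card E" arbitrary: E rule: less_induct)
  case (less E)
  note A = less.prems
  have vu: "l v \<le> l u" using A by auto
  show ?case
  proof (cases "E = {u, v}")
    case True
    then show ?thesis using liftable_two[of u v l] A vu by auto
  next
    case False
    then obtain e where e: "e \<in> E" "e \<noteq> u" "e \<noteq> v" using A(2,3) by blast
    have E: "insert e (E - {e}) = E" using e by auto
    show ?thesis
    proof (cases "l v < l u \<or> E - {e} \<noteq> {u, v}")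
      case True
      have "card (E - {e}) < card E" using A(1) e(1) by (rule card_Diff1_less)
      then have "liftable l (E - {e}) (folded l (E - {e}) u v)"
        by (rule less.hyps) (use A e in auto)
      then have "liftable l (insert e (E - {e})) (folded l (insert e (E - {e})) u v)"
        using True A e vu by (intro liftable_insert_folded) auto
      then show ?thesis unfolding E .
    next
      case False
      then have "E = {u, v, e}" using E by auto
      then show ?thesis using liftable_three_isosceles[of u v e l] A e vu False by force
    qed
  qed
qed

section \<open>The moduli space\<close>

definition dirs :: "(nat \<Rightarrow> real) \<Rightarrow> (nat \<Rightarrow> complex) \<Rightarrow> nat \<Rightarrow> complex" where
  "dirs l p i = (p (Suc i) - p i) / l i"

text \<open>The first vertex sits at the origin; the restriction puts the function into the
  extensional function space.\<close>

definition chain_conf :: "nat \<Rightarrow> (nat \<Rightarrow> real) \<Rightarrow> (nat \<Rightarrow> complex) \<Rightarrow> nat \<Rightarrow> complex" where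
  "chain_conf k l z = (\<lambda>i\<in>{1..k+1}. esum l {1..<i} z)"

lemma conf_spaceD: "p \<in> conf_space k l \<Longrightarrow> i \<in> {1..k} \<Longrightarrow> cmod (p i - p (Suc i)) = l i"
  by (simp add: conf_space_def)

lemma unimod_dirs:
  assumes "p \<in> conf_space k l" "\<And>i. i \<in> {1..k} \<Longrightarrow> l i > 0"
  shows "unimod {1..k} (dirs l p)"
  unfolding unimod_def
proof
  fix i assume i: "i \<in> {1..k}"
  show "cmod (dirs l p i) = 1"
    using conf_spaceD[OF assms(1) i] assms(2)[OF i] by (simp add: dirs_def norm_divide norm_minus_commute)
qed

lemma esum_dirs:
  assumes "\<And>i. i \<in> {1..k} \<Longrightarrow> l i \<noteq> 0" "i \<in> {1..k+1}"
  shows "esum l {1..<i} (dirs l p) = p i - p 1"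
proof -
  have "esum l {1..<i} (dirs l p) = (\<Sum>j=1..<i. p (Suc j) - p j)"
    unfolding esum_def dirs_def using assms by (intro sum.cong) auto
  also have "\<dots> = p i - p 1" using assms(2) by (intro sum_Suc_diff') auto
  finally show ?thesis .
qed

lemma chain_conf_in_conf_space:
  assumes "unimod {1..k} z" "\<And>i. i \<in> {1..k} \<Longrightarrow> l i > 0"
  shows "chain_conf k l z \<in> conf_space k l"
  unfolding conf_space_def
proof (intro CollectI conjI ballI)
  show "chain_conf k l z \<in> {1..k + 1} \<rightarrow>\<^sub>E UNIV" by (auto simp: chain_conf_def)
  fix i assume i: "i \<in> {1..k}"
  have "chain_conf k l z (Suc i) - chain_conf k l z i = complex_of_real (l i) * z i"
    using i by (simp add: chain_conf_def esum_def)
  then show "cmod (chain_conf k l z i - chain_conf k l z (Suc i)) = l i"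
    using assms(1) assms(2)[OF i] i by (subst norm_minus_commute) (simp add: norm_mult unimod_def)
qed

section \<open>Orbits under isometries and the end distance on them\<close>

lemma orient_iso_inverse:
  assumes "orient_iso g"
  obtains g' where "orient_iso g'" "\<And>z. g' (g z) = z"
proof -
  obtain a b where g: "cmod a = 1" "g = (\<lambda>z. a * z + b)" using assms by (auto simp: orient_iso_def)
  then have "a \<noteq> 0" by auto
  show ?thesis
  proof (rule that[of "\<lambda>z. (1/a) * z + (- b/a)"])
    show "orient_iso (\<lambda>z. (1/a) * z + (- b/a))"
      unfolding orient_iso_def using g by (intro exI[of _ "1/a"] exI[of _ "- b/a"]) (simp add: norm_divide)
    show "(1/a) * g z + (- b/a) = z" for z using \<open>a \<noteq> 0\<close> by (simp add: g field_simps)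
  qed
qed

lemma orient_iso_comp:
  assumes "orient_iso g" "orient_iso g'"
  shows "orient_iso (g \<circ> g')"
proof -
  obtain a b c d where "cmod a = 1" "g = (\<lambda>z. a * z + b)" "cmod c = 1" "g' = (\<lambda>z. c * z + d)"
    using assms unfolding orient_iso_def by blast
  then show ?thesis unfolding orient_iso_def
    by (intro exI[of _ "a * c"] exI[of _ "a * d + b"]) (auto simp: norm_mult algebra_simps)
qed

lemma orbit_mono:
  assumes "orient_iso g" "\<And>i. i \<in> {1..k+1} \<Longrightarrow> p i = g (q i)"
  shows "orbit k l p \<subseteq> orbit k l q"
proof
  fix r assume "r \<in> orbit k l p"
  then obtain g' where r: "r \<in> conf_space k l" "orient_iso g'" "\<And>i. i \<in> {1..k+1} \<Longrightarrow> r i = g' (p i)"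
    by (auto simp: orbit_def)
  then show "r \<in> orbit k l q" unfolding orbit_def using orient_iso_comp[OF r(2) assms(1)] assms(2)
    by (intro CollectI conjI exI[of _ "g' \<circ> g"]) auto
qed

lemma orbit_eqI:
  assumes g: "orient_iso g" "\<And>i. i \<in> {1..k+1} \<Longrightarrow> p i = g (q i)"
  shows "orbit k l p = orbit k l q"
proof
  obtain g' where g': "orient_iso g'" "\<And>z. g' (g z) = z"
    using orient_iso_inverse[OF g(1)] by blast
  show "orbit k l p \<subseteq> orbit k l q" by (rule orbit_mono[OF g])
  show "orbit k l q \<subseteq> orbit k l p" by (rule orbit_mono[OF g'(1)]) (simp add: g g')
qed

lemma orbit_self: "p \<in> conf_space k l \<Longrightarrow> p \<in> orbit k l p"
  unfolding orbit_def orient_iso_def by (intro CollectI conjI exI[of _ "\<lambda>z. 1 * z + 0"] exI[of _ 1] exI[of _ 0]) auto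

text \<open>The rebuilt configuration is the translate of \<open>p\<close> by
  \<open>- p 1\<close>.\<close>

lemma orbit_chain_conf_dirs:
  assumes "\<And>i. i \<in> {1..k} \<Longrightarrow> l i > 0"
  shows "orbit k l (chain_conf k l (dirs l p)) = orbit k l p"
proof (rule orbit_eqI)
  show "orient_iso (\<lambda>z. 1 * z + (- p 1))" unfolding orient_iso_def by (intro exI[of _ 1] exI[of _ "- p 1"]) simp
  show "chain_conf k l (dirs l p) i = 1 * p i + (- p 1)" if "i \<in> {1..k+1}" for i
    using esum_dirs[of k l i p] assms that by (force simp: chain_conf_def)
qed

text \<open>The end distance is constant on an orbit, so the choice in \<open>theta\<close> has only
  one possible value.\<close>

lemma theta_orbit:
  assumes p: "p \<in> conf_space k l"
  shows "theta k (orbit k l p) = cmod (p 1 - p (k+1))"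
proof -
  have inv: "cmod (q 1 - q (k+1)) = cmod (p 1 - p (k+1))" if q: "q \<in> orbit k l p" for q
  proof -
    obtain a b where a: "cmod a = 1" and "\<And>i. i \<in> {1..k+1} \<Longrightarrow> q i = a * p i + b"
      using q by (auto simp: orbit_def orient_iso_def)
    then have "q 1 - q (k+1) = a * (p 1 - p (k+1))" by (simp add: algebra_simps)
    then show ?thesis using a by (simp add: norm_mult)
  qed
  show ?thesis
    unfolding theta_def
  proof (rule some_equality)
    show "\<exists>q\<in>orbit k l p. cmod (p 1 - p (k+1)) = cmod (q 1 - q (k+1))" using orbit_self[OF p] by blast
  qed (use inv in blast)
qed

lemma theta_orbit_dirs:
  assumes "p \<in> conf_space k l" "\<And>i. i \<in> {1..k} \<Longrightarrow> l i > 0"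
  shows "theta k (orbit k l p) = cmod (esum l {1..k} (dirs l p))"
proof -
  have "esum l {1..<k+1} (dirs l p) = p (k+1) - p 1" using assms(2) by (intro esum_dirs[of k]) force+
  moreover have "{1..<k+1} = {1..k}" by auto
  ultimately show ?thesis using theta_orbit[OF assms(1)] by (simp add: norm_minus_commute)
qed

lemma theta_chain_conf:
  assumes "unimod {1..k} z" "\<And>i. i \<in> {1..k} \<Longrightarrow> l i > 0"
  shows "theta k (orbit k l (chain_conf k l z)) = cmod (esum l {1..k} z)"
proof -
  have "chain_conf k l z \<in> conf_space k l" using assms by (rule chain_conf_in_conf_space)
  then have "theta k (orbit k l (chain_conf k l z)) = cmod (chain_conf k l z 1 - chain_conf k l z (k+1))"
    by (rule theta_orbit)
  moreover have "chain_conf k l z 1 = 0" by (simp add: chain_conf_def esum_def)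
  moreover have "chain_conf k l z (k+1) = esum l {1..<k+1} z" unfolding chain_conf_def by simp
  moreover have "{1..<k+1} = {1..k}" by auto
  ultimately show ?thesis by simp
qed

lemma range_P_subset_reach:
  assumes "\<And>i. i \<in> {1..k} \<Longrightarrow> l i > 0"
  shows "range_P k l \<subseteq> reach l {1..k}"
proof
  fix x assume "x \<in> range_P k l"
  then obtain p where p: "p \<in> conf_space k l" "x = theta k (orbit k l p)"
    by (auto simp: range_P_def moduli_def)
  have "x = cmod (esum l {1..k} (dirs l p))" using theta_orbit_dirs[of p k l] p assms by simp
  then show "x \<in> reach l {1..k}"
    using esum_in_reach[of "{1..k}" "dirs l p" l] unimod_dirs[of p k l] p(1) assms
    by (simp add: less_imp_le)
qed

section \<open>The quotient topology\<close>

lemma topspace_moduli_top: "topspace (moduli_top k l) = moduli k l"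
proof -
  have "{p \<in> conf_space k l. orbit k l p \<in> moduli k l} = topspace (conf_top k l)"
    by (auto simp: moduli_def topspace_conf_top)
  then have "openin (moduli_top k l) (moduli k l)"
    unfolding openin_moduli_top topspace_conf_top using openin_topspace[of "conf_top k l", unfolded topspace_conf_top] by simp
  then show ?thesis by (auto simp: openin_moduli_top topspace_def)
qed

lemma continuous_map_orbit: "continuous_map (conf_top k l) (moduli_top k l) (orbit k l)"
  unfolding continuous_map topspace_moduli_top topspace_conf_top
  by (auto simp: moduli_def openin_moduli_top topspace_conf_top)

lemma continuous_map_chain_conf:
  assumes Z: "\<And>i. i \<in> {1..k} \<Longrightarrow> continuous_on S (\<lambda>t. Z t i)"
    and u: "\<And>t. t \<in> S \<Longrightarrow> unimod {1..k} (Z t)" and l: "\<And>i. i \<in> {1..k} \<Longrightarrow> l i > 0"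
  shows "continuous_map (top_of_set S) (conf_top k l) (\<lambda>t. chain_conf k l (Z t))"
  unfolding conf_top_def continuous_map_in_subtopology continuous_map_componentwise
proof (intro conjI ballI)
  show "(\<lambda>t. chain_conf k l (Z t)) ` topspace (top_of_set S) \<subseteq> extensional {1..k + 1}"
    by (auto simp: chain_conf_def)
  fix i assume i: "i \<in> {1..k+1}"
  have "continuous_on S (\<lambda>t. esum l {1..<i} (Z t))"
    unfolding esum_def by (intro continuous_intros Z) (use i in auto)
  then show "continuous_map (top_of_set S) euclidean (\<lambda>t. chain_conf k l (Z t) i)"
    using i by (simp add: chain_conf_def)
qed (use chain_conf_in_conf_space[OF u l] in auto)

text \<open>If \<open>u\<close> and \<open>v\<close> are never parallel in the fibre, the sign of the angle between them
  separates the fibre, and reflection exchanges the two parts.\<close>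

lemma nabla_subset_folded:
  assumes l: "\<And>i. i \<in> {1..k} \<Longrightarrow> l i > 0" and uv: "u \<in> {1..k}" "v \<in> {1..k}"
  shows "nabla k l \<subseteq> folded l {1..k} u v"
proof
  fix x assume x: "x \<in> nabla k l"
  define C where "C = {c \<in> moduli k l. theta k c = x}"
  have con: "connectedin (moduli_top k l) C" and xr: "x \<in> range_P k l"
    using x by (auto simp: nabla_def C_def)
  \<comment> \<open>On configurations this is \<open>l u * l v\<close> times the sine of the angle
    from edge \<open>v\<close> to edge \<open>u\<close>.\<close>
  define D where "D p = Im ((p (Suc u) - p u) * cnj (p (Suc v) - p v))" for p :: "nat \<Rightarrow> complex"
  show "x \<in> folded l {1..k} u v"
  proof (rule ccontr)
    assume nf: "x \<notin> folded l {1..k} u v"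
    have D0: "D p \<noteq> 0" if p: "p \<in> conf_space k l" "theta k (orbit k l p) = x" for p
    proof
      assume D: "D p = 0"
      have z: "unimod {1..k} (dirs l p)" by (rule unimod_dirs[OF p(1) l])
      have lu: "l u > 0" "l v > 0" using l uv by auto
      define w where "w = dirs l p u * cnj (dirs l p v)"
      have n: "cmod (dirs l p u) = 1" "cmod (dirs l p v) = 1" using z uv by (auto simp: unimod_def)
      have "w = ((p (Suc u) - p u) * cnj (p (Suc v) - p v)) / of_real (l u * l v)"
        by (simp add: w_def dirs_def)
      then have "Im w = 0" using D lu by (simp only: Im_divide_of_real D_def)
      moreover have "cmod w = 1" using n by (simp add: w_def norm_mult)
      ultimately have "w = 1 \<or> w = -1" by (auto simp: complex_eq_iff cmod_def abs_if split: if_splits)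
      moreover have "w * dirs l p v = dirs l p u"
        using n complex_norm_square[of "dirs l p v"] by (simp add: w_def mult.assoc mult.commute)
      ultimately have "dirs l p u = dirs l p v \<or> dirs l p u = - dirs l p v" by auto
      then have "x \<in> folded l {1..k} u v"
        using z theta_orbit_dirs[OF p(1) l] p(2) by (auto simp: folded_def)
      then show False using nf by simp
    qed
    have Dorb: "D q = D p" if q: "q \<in> orbit k l p" for p q
    proof -
      obtain a b where a: "cmod a = 1" and ab: "\<And>i. i \<in> {1..k+1} \<Longrightarrow> q i = a * p i + b"
        using q by (auto simp: orbit_def orient_iso_def)
      have s: "q (Suc i) - q i = a * (p (Suc i) - p i)" if "i \<in> {1..k}" for i
        using ab[of i] ab[of "Suc i"] that by (simp add: algebra_simps)
      have "(q (Suc u) - q u) * cnj (q (Suc v) - q v) =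
          (a * cnj a) * ((p (Suc u) - p u) * cnj (p (Suc v) - p v))"
        unfolding s[OF uv(1)] s[OF uv(2)] by (simp add: algebra_simps)
      also have "a * cnj a = 1" using a complex_norm_square[of a] by simp
      finally show ?thesis unfolding D_def by simp
    qed
    have pr: "continuous_map (conf_top k l) euclidean (\<lambda>p. p i)" if "i \<in> {1..k+1}" for i
      unfolding conf_top_def
      using that by (intro continuous_map_from_subtopology continuous_map_product_projection)
    have re: "continuous_map (conf_top k l) euclidean (\<lambda>p. Re (p i))" if "i \<in> {1..k+1}" for i
      using continuous_map_compose[OF pr[OF that], of euclidean Re]
      by (simp add: o_def continuous_map_iff_continuous2 continuous_on_Re)
    have im: "continuous_map (conf_top k l) euclidean (\<lambda>p. Im (p i))" if "i \<in> {1..k+1}" for i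
      using continuous_map_compose[OF pr[OF that], of euclidean Im]
      by (simp add: o_def continuous_map_iff_continuous2 continuous_on_Im)
    have "D = (\<lambda>p. (Im (p (Suc u)) - Im (p u)) * (Re (p (Suc v)) - Re (p v)) -
        (Re (p (Suc u)) - Re (p u)) * (Im (p (Suc v)) - Im (p v)))"
      by (rule ext) (simp add: D_def algebra_simps)
    moreover have "continuous_map (conf_top k l) euclidean \<dots>"
      by (intro continuous_map_diff continuous_map_real_mult re im) (use uv in auto)
    ultimately have cD: "continuous_map (conf_top k l) euclidean D" by (simp only:)
    have op: "openin (conf_top k l) {p \<in> topspace (conf_top k l). D p \<in> W}" if "open W" for W
      by (rule openin_continuous_map_preimage[OF cD]) (use that in simp)
    \<comment> \<open>By \<open>Dorb\<close> the choice of the member is immaterial, so the preimage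
      of \<open>A W\<close> in the configuration space is the preimage of \<open>W\<close> under
      \<open>D\<close>.\<close>
    define A where "A W = {c \<in> moduli k l. \<exists>p\<in>c. D p \<in> W}" for W :: "real set"
    have Aorb: "orbit k l p \<in> A W \<longleftrightarrow> D p \<in> W" if "p \<in> conf_space k l" for p W
    proof
      assume "orbit k l p \<in> A W"
      then obtain q where "q \<in> orbit k l p" "D q \<in> W" unfolding A_def by blast
      then show "D p \<in> W" using Dorb by simp
    next
      assume "D p \<in> W"
      moreover have "orbit k l p \<in> moduli k l" using that by (simp add: moduli_def)
      ultimately show "orbit k l p \<in> A W" unfolding A_def using orbit_self[OF that] by blast
    qed
    have opA: "openin (moduli_top k l) (A W)" if "open W" for W
      unfolding openin_moduli_top
    proof
      have "{p \<in> topspace (conf_top k l). orbit k l p \<in> A W} = {p \<in> topspace (conf_top k l). D p \<in> W}"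
        using Aorb by (auto simp: topspace_conf_top)
      then show "openin (conf_top k l) {p \<in> topspace (conf_top k l). orbit k l p \<in> A W}"
        using op[OF that] by simp
    qed (auto simp: A_def)
    have cover: "C \<subseteq> A {0<..} \<union> A {..<0}"
    proof
      fix c assume "c \<in> C"
      then obtain p where p: "p \<in> conf_space k l" "c = orbit k l p" "theta k c = x"
        by (auto simp: C_def moduli_def)
      have "D p \<noteq> 0" using D0[OF p(1)] p(3) unfolding p(2) by blast
      then show "c \<in> A {0<..} \<union> A {..<0}" unfolding p(2) Un_iff Aorb[OF p(1)] by auto
    qed
    have disj: "A {0<..} \<inter> A {..<0} \<inter> C = {}"
    proof -
      have "False" if c: "c \<in> A {0<..}" "c \<in> A {..<0}" for c
      proof -
        have "c \<in> moduli k l" using c(1) by (simp add: A_def)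
        then obtain p where p: "p \<in> conf_space k l" "c = orbit k l p" unfolding moduli_def by blast
        show False using c unfolding p(2) Aorb[OF p(1)] by simp
      qed
      then show ?thesis by blast
    qed
    obtain p where p: "p \<in> conf_space k l" "theta k (orbit k l p) = x"
      using xr by (auto simp: range_P_def moduli_def)
    \<comment> \<open>The mirror image lies in the same fibre and has the opposite sign of
      \<open>D\<close>, so both open parts meet \<open>C\<close>.\<close>
    define p' where "p' = (\<lambda>i\<in>{1..k+1}. cnj (p i))"
    have p': "p' \<in> conf_space k l"
      using p(1) by (auto simp: conf_space_def p'_def simp flip: complex_cnj_diff)
    have "theta k (orbit k l p') = x"
      unfolding theta_orbit[OF p'] p(2)[symmetric] theta_orbit[OF p(1)]
      by (simp add: p'_def flip: complex_cnj_diff)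
    then have C: "orbit k l p \<in> C" "orbit k l p' \<in> C" using p p' by (auto simp: C_def moduli_def)
    have "D p' = - D p" using uv by (simp add: D_def p'_def algebra_simps)
    then have "D p > 0 \<and> D p' < 0 \<or> D p < 0 \<and> D p' > 0" using D0[OF p] by linarith
    then have "A {0<..} \<inter> C \<noteq> {}" "A {..<0} \<inter> C \<noteq> {}"
      using C Aorb[OF p(1), of "{0<..}"] Aorb[OF p', of "{0<..}"]
        Aorb[OF p(1), of "{..<0}"] Aorb[OF p', of "{..<0}"] by (simp_all, blast+)
    then have "\<not> connectedin (moduli_top k l) C"
      unfolding connectedin using cover disj opA[OF open_greaterThan] opA[OF open_lessThan]
      by (intro notI, elim conjE notE, intro exI[of _ "A {0<..}"] exI[of _ "A {..<0}"] conjI)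
    then show False using con by contradiction
  qed
qed

section \<open>Lifting in the moduli space\<close>

lemma ex_max_on:
  fixes f :: "'a \<Rightarrow> 'b :: linorder"
  assumes "finite A" "A \<noteq> {}"
  shows "\<exists>u\<in>A. \<forall>i\<in>A. f i \<le> f u"
proof -
  have "Max (f ` A) \<in> f ` A" using assms by simp
  then obtain u where "u \<in> A" "f u = Max (f ` A)" by auto
  then show ?thesis using assms by (intro bexI[of _ u]) auto
qed

theorem mainTheorem8:
  fixes k :: nat and l :: "nat \<Rightarrow> real"
    and p q :: "(nat \<Rightarrow> complex) set" and \<alpha> :: "real \<Rightarrow> real"
    and \<epsilon> \<delta> :: real
  assumes "k \<ge> 2"
    and "\<forall>i\<in>{1..k}. l i > 0"
    and "p \<in> moduli k l" and "q \<in> moduli k l"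
    and "continuous_on {0..1} \<alpha>" and "\<alpha> ` {0..1} \<subseteq> range_P k l"
    and "\<epsilon> > 0" and "\<delta> > 0"
    and "\<forall>x\<in>{0..1}. x \<le> \<epsilon> \<longrightarrow> \<alpha> x = theta k p"
    and "\<forall>x\<in>{0..1}. 1 - \<delta> \<le> x \<longrightarrow> \<alpha> x = theta k q"
    and "\<alpha> ` {0..1} \<inter> nabla k l \<noteq> {}"
  shows "\<exists>\<alpha>'. continuous_map (top_of_set {0..1}) (moduli_top k l) \<alpha>'
            \<and> \<alpha>' 0 = p \<and> \<alpha>' 1 = q \<and> (\<forall>x\<in>{0..1}. theta k (\<alpha>' x) = \<alpha> x)"
proof -
  have l: "\<And>i. i \<in> {1..k} \<Longrightarrow> l i > 0" using assms(2) by blast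
  obtain p0 where p0: "p0 \<in> conf_space k l" "p = orbit k l p0" using assms(3) by (auto simp: moduli_def)
  obtain q0 where q0: "q0 \<in> conf_space k l" "q = orbit k l q0" using assms(4) by (auto simp: moduli_def)
  have "finite {1..k}" "{1..k} \<noteq> {}" using assms(1) by auto
  \<comment> \<open>\<open>u\<close> is a longest edge and \<open>v\<close> a longest one among the
    others, as \<open>liftable_folded\<close> demands.\<close>
  then obtain u where u: "u \<in> {1..k}" "\<And>i. i \<in> {1..k} \<Longrightarrow> l i \<le> l u"
    using ex_max_on[of "{1..k}" l] by blast
  have "card ({1..k} - {u}) > 0" using u assms(1) by simp
  then have "finite ({1..k} - {u})" "{1..k} - {u} \<noteq> {}" by (auto simp: card_gt_0_iff)
  then obtain v where v: "v \<in> {1..k} - {u}" "\<And>i. i \<in> {1..k} - {u} \<Longrightarrow> l i \<le> l v"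
    using ex_max_on[of "{1..k} - {u}" l] by blast
  have L: "liftable l {1..k} (folded l {1..k} u v)"
    by (rule liftable_folded) (use u v l in auto)
  \<comment> \<open>A common length for both constant stretches; \<epsilon> and \<delta> may exceed
    1/2.\<close>
  define \<eta> where "\<eta> = min (1/2) (min \<epsilon> \<delta>)"
  have \<eta>: "0 < \<eta>" "\<eta> \<le> 1/2" "\<eta> \<le> \<epsilon>" "\<eta> \<le> \<delta>" using assms(7,8) by (auto simp: \<eta>_def)
  have a0: "\<alpha> t = theta k p" if "0 \<le> t" "t \<le> \<eta>" for t using assms(9) that \<eta> by auto
  have a1: "\<alpha> t = theta k q" if "1 - \<eta> \<le> t" "t \<le> 1" for t using assms(10) that \<eta> by auto
  have "flat_ends \<eta> \<alpha>"
    unfolding flat_ends_def using \<eta> by (auto simp: a0 a1)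
  moreover have "\<alpha> ` {0..1} \<subseteq> reach l {1..k}"
    using assms(6) range_P_subset_reach[of k l] l by blast
  moreover have "cmod (esum l {1..k} (dirs l p0)) = \<alpha> 0" "cmod (esum l {1..k} (dirs l q0)) = \<alpha> 1"
    using theta_orbit_dirs[OF p0(1) l] theta_orbit_dirs[OF q0(1) l] p0 q0 a0[of 0] a1[of 1] \<eta> by auto
  moreover obtain t where "t \<in> {0..1}" "\<alpha> t \<in> folded l {1..k} u v"
    using assms(11) nabla_subset_folded[of k l u v] l u v by blast
  ultimately have "joined l {1..k} \<alpha> (dirs l p0) (dirs l q0)"
    using liftableD(2)[OF L assms(5)] unimod_dirs[OF p0(1) l] unimod_dirs[OF q0(1) l] by blast
  then obtain Z where Z: "lifts l {1..k} \<alpha> Z" "\<And>i. i \<in> {1..k} \<Longrightarrow> Z 0 i = dirs l p0 i \<and> Z 1 i = dirs l q0 i"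
    unfolding joined_def by blast
  have Zu: "unimod {1..k} (Z t)" "cmod (esum l {1..k} (Z t)) = \<alpha> t" if "t \<in> {0..1}" for t
    using Z(1) that by (auto simp: lifts_def)
  \<comment> \<open>\<open>Z\<close> matches the given directions only on \<open>{1..k}\<close>, and
    \<open>chain_conf\<close> depends on no others.\<close>
  have ch: "chain_conf k l (Z 0) = chain_conf k l (dirs l p0)" "chain_conf k l (Z 1) = chain_conf k l (dirs l q0)"
    unfolding chain_conf_def using Z(2) by (auto intro!: restrict_ext esum_cong)
  show ?thesis
  proof (intro exI[of _ "\<lambda>t. orbit k l (chain_conf k l (Z t))"] conjI ballI)
    have "continuous_map (top_of_set {0..1}) (conf_top k l) (\<lambda>t. chain_conf k l (Z t))"
      by (rule continuous_map_chain_conf) (use Z(1) Zu l in \<open>auto simp: lifts_def\<close>)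
    then show "continuous_map (top_of_set {0..1}) (moduli_top k l) (\<lambda>t. orbit k l (chain_conf k l (Z t)))"
      using continuous_map_compose[OF _ continuous_map_orbit] by (simp add: o_def)
    show "orbit k l (chain_conf k l (Z 0)) = p" "orbit k l (chain_conf k l (Z 1)) = q"
      unfolding ch p0 q0 by (rule orbit_chain_conf_dirs[OF l], assumption)+
    show "theta k (orbit k l (chain_conf k l (Z x))) = \<alpha> x" if "x \<in> {0..1}" for x
      using theta_chain_conf[OF Zu(1)[OF that] l] Zu(2)[OF that] by simp
  qed
qed

end
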